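(* The entropy function $a\mapsto h_{top}(f|_{\Lambda_a})$, $a\in\left[\tfrac13,\tfrac12\right]$, is a devil's staircase.
   Context: $f(x)=2x\bmod1$ is the doubling map on the circle (points represented in $[0,1]$). For $a\in[\frac13,\frac12]$ let $U=(a,1-a)$ and $\Lambda_a=\left([0,1]\setminus\bigcup_{n\ge0}f^{-n}(U)\right)\cap[1-2a,2a]$, the attractor of the doubling map with hole $U$. $h_{top}$ is topological entropy, with logarithms in base $2$. A function $g:[\alpha,\beta]\to\mathbb R$ is a devil's staircase if: (1) $g$ is continuous; (2) $g(\alpha)<g(\beta)$ (or $g(\alpha)>g(\beta)$); (3) $g$ is non-decreasing (or, respectively, non-increasing) on $[\alpha,\beta]$; (4) there is a set $N$ of Lebesgue measure $0$ such that for all $x\in[\alpha,\beta]\setminus N$ the derivative of $g$ at $x$ exists and is zero. *)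

theory Defs
  imports "HOL-Analysis.Analysis"
begin

section \<open>Topological entropy\<close>

text \<open>Bowen's definition for a map \<open>f\<close> of a compact metric space. A set is \<open>(n, \<epsilon>)\<close>-separated if
  any two distinct points of it are more than \<open>\<epsilon>\<close> apart in the metric
  \<open>d\<^sub>n x y = max {d (f^i x) (f^i y) | i < n}\<close>.\<close>

definition separated_sets :: "'a metric \<Rightarrow> ('a \<Rightarrow> 'a) \<Rightarrow> nat \<Rightarrow> real \<Rightarrow> 'a set set" where
  "separated_sets m f n \<epsilon> =
     {E. finite E \<and> E \<subseteq> mspace m \<and>
         (\<forall>x\<in>E. \<forall>y\<in>E. x \<noteq> y \<longrightarrow> (\<exists>i<n. \<epsilon> < mdist m ((f ^^ i) x) ((f ^^ i) y)))}"

text \<open>With \<open>s(n, \<epsilon>)\<close> the maximal cardinality of an \<open>(n, \<epsilon>)\<close>-separated set, this is the limit as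
  \<open>\<epsilon> \<rightarrow> 0\<close> of \<open>limsup (log\<^sub>2 s(n, \<epsilon>) / n)\<close>. The limit is a supremum by monotonicity in \<open>\<epsilon>\<close>; the
  maximum over separated sets is taken after the (monotone) logarithm, so that no maximum of a
  possibly unbounded set of naturals occurs.\<close>

definition topological_entropy :: "'a metric \<Rightarrow> ('a \<Rightarrow> 'a) \<Rightarrow> ereal" where
  "topological_entropy m f =
     (SUP \<epsilon>\<in>{0<..}. limsup (\<lambda>n. SUP E\<in>separated_sets m f n \<epsilon>. ereal (log 2 (real (card E)) / real n)))"

section \<open>The doubling map on the circle\<close>

text \<open>The circle is \<open>[0,1)\<close> with the arc length metric of \<open>\<real>/\<int>\<close>; the quotient map to it from \<open>[0,1]\<close>,
  which glues \<open>0\<close> and \<open>1\<close>, is \<^term>\<open>frac\<close>.\<close>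

definition circle_dist :: "real \<Rightarrow> real \<Rightarrow> real" where
  "circle_dist x y = min (frac (x - y)) (frac (y - x))"

definition circle :: "real metric" where
  "circle = metric ({0..<1}, circle_dist)"

definition doubling :: "real \<Rightarrow> real" where
  "doubling x = frac (2 * x)"

definition hole :: "real \<Rightarrow> real set" where
  "hole a = {a<..<1 - a}"

definition attractor :: "real \<Rightarrow> real set" where
  "attractor a = ({0..1} - (\<Union>n. (doubling ^^ n) -` hole a)) \<inter> {1 - 2 * a..2 * a}"

text \<open>The image under \<^term>\<open>frac\<close> differs from \<^term>\<open>attractor a\<close> only for \<open>a = 1/2\<close>, where the
  endpoints \<open>0\<close> and \<open>1\<close> are the same point of the circle.\<close>

definition attractor_space :: "real \<Rightarrow> real metric" where
  "attractor_space a = submetric circle (frac ` attractor a)"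

section \<open>Devil's staircases\<close>

definition devils_staircase :: "real \<Rightarrow> real \<Rightarrow> (real \<Rightarrow> real) \<Rightarrow> bool" where
  "devils_staircase \<alpha> \<beta> g \<longleftrightarrow>
     \<alpha> < \<beta> \<and>
     continuous_on {\<alpha>..\<beta>} g \<and>
     (g \<alpha> < g \<beta> \<and> mono_on {\<alpha>..\<beta>} g \<or> g \<alpha> > g \<beta> \<and> antimono_on {\<alpha>..\<beta>} g) \<and>
     (\<exists>N \<in> null_sets lebesgue. \<forall>x \<in> {\<alpha>..\<beta>} - N. (g has_real_derivative 0) (at x within {\<alpha>..\<beta>}))"

section \<open>Basic facts\<close>

lemma circle_dist_eq:
  assumes "x \<in> {0..<1}" "y \<in> {0..<1}"
  shows "circle_dist x y = min \<bar>x - y\<bar> (1 - \<bar>x - y\<bar>)"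
proof -
  have f1: "frac t = t" if "0 \<le> t" "t < 1" for t :: real
    using that by (simp add: frac_eq)
  have f2: "frac t = 1 + t" if "t < 0" "-1 < t" for t :: real
    using that frac_unique_iff[of t "1 + t"] by auto
  consider "x = y" | "x < y" | "y < x" by linarith
  then show ?thesis
  proof cases
    case 2
    then show ?thesis using assms f1[of "y - x"] f2[of "x - y"] by (simp add: circle_dist_def min_def)
  next
    case 3
    then show ?thesis using assms f1[of "x - y"] f2[of "y - x"] by (simp add: circle_dist_def min_def)
  qed (simp add: circle_dist_def)
qed

lemma Metric_space_circle: "Metric_space {0..<1} circle_dist"
proof
  show "0 \<le> circle_dist x y" for x y by (simp add: circle_dist_def)
  show "circle_dist x y = circle_dist y x" for x y by (simp add: circle_dist_def min.commute)
  show "circle_dist x y = 0 \<longleftrightarrow> x = y" if "x \<in> {0..<1}" "y \<in> {0..<1}" for x y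
    using that by (auto simp: circle_dist_eq min_def)
  show "circle_dist x z \<le> circle_dist x y + circle_dist y z"
    if "x \<in> {0..<1}" "y \<in> {0..<1}" "z \<in> {0..<1}" for x y z
    using that by (auto simp: circle_dist_eq min_def abs_if)
qed

lemma mspace_circle [simp]: "mspace circle = {0..<1}"
  and mdist_circle [simp]: "mdist circle = circle_dist"
  by (simp_all add: circle_def Metric_space.mspace_metric Metric_space.mdist_metric Metric_space_circle)

lemma mdist_attractor_space [simp]: "mdist (attractor_space a) = circle_dist"
  by (simp add: attractor_space_def)

lemma mspace_attractor_space [simp]: "mspace (attractor_space a) = frac ` attractor a"
  by (auto simp: attractor_space_def frac_lt_1)

lemma doubling_frac: "doubling (frac x) = doubling x"
proof -
  have "2 * frac x = 2 * x - of_int (2 * \<lfloor>x\<rfloor>)" by (simp add: frac_def)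
  then show ?thesis
    by (metis doubling_def frac_def floor_diff_of_int of_int_diff diff_diff_eq2 diff_add_eq add_diff_cancel_right')
qed

lemma doubling_attractor:
  assumes "a \<in> {1/3..1/2}" "x \<in> attractor a"
  shows "doubling x \<in> frac ` attractor a"
proof -
  have nothole: "(doubling ^^ n) x \<notin> hole a" for n
    using assms by (auto simp: attractor_def)
  have orbit: "(doubling ^^ n) (doubling x) \<notin> hole a" for n
    using nothole[of "Suc n"] by (simp only: funpow_Suc_right o_apply not_False_eq_True)
  have bounds: "x \<le> a \<or> x \<ge> 1 - a" "1 - 2 * a \<le> x" "x \<le> 2 * a" "0 \<le> x" "x \<le> 1"
    using nothole[of 0] assms by (auto simp: hole_def attractor_def)
  have a: "1/3 \<le> a" "a \<le> 1/2" using assms by auto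
  show ?thesis
  proof (cases "2 * x = 1 \<or> x = 1")
    case True
    then have d0: "doubling x = 0" by (auto simp: doubling_def)
    have "a = 1/2" using True bounds a by auto
    then have "hole a = {}" by (simp add: hole_def)
    then have "0 \<in> attractor a" by (simp add: attractor_def \<open>a = 1/2\<close>)
    then show ?thesis using d0 by (intro image_eqI[of _ _ 0]) auto
  next
    case False
    have "1 - 2 * a \<le> doubling x \<and> doubling x \<le> 2 * a \<and> doubling x \<le> 1 \<and> 0 \<le> doubling x"
    proof (cases "2 * x < 1")
      case True
      then have "doubling x = 2 * x" using bounds by (simp add: doubling_def frac_eq)
      then show ?thesis using True bounds a by auto
    next
      case F: False
      have "doubling x = 2 * x - 1"
        unfolding doubling_def frac_unique_iff using F False bounds by auto
      then show ?thesis using F False bounds a by auto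
    qed
    then have "doubling x \<in> attractor a" using orbit by (auto simp: attractor_def)
    moreover have "frac (doubling x) = doubling x" by (simp add: doubling_def)
    ultimately show ?thesis by (metis image_eqI)
  qed
qed

lemma doubling_attractor_space:
  assumes "a \<in> {1/3..1/2}"
  shows "doubling ` mspace (attractor_space a) \<subseteq> mspace (attractor_space a)"
  using doubling_attractor[OF assms] by (auto simp: doubling_frac)

end

(* The folding x |-> 2 min(x, 1 - x) semiconjugates the doubling map to the tent map T and turns the
   hole (a, 1 - a) into (t, 1] with t = 2 a. Hence the entropy is log 2 of the exponential growth rate
   of the number of dyadic cells of level n that contain a point v with T^i v <= t for i < n: separated
   sets are bounded by cells, and conversely cells meeting the core [2 - 2 t, t] supply them.

   Compactness of the cells makes the growth rate right continuous. If T^k t > t for some k, survivors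
   cannot visit a neighbourhood of t, so the rate is locally constant at t. Otherwise the Milnor-Thurston
   kneading identity expresses the generating function F of the cell counts, up to an error bounded
   uniformly in t, as a quotient by a power series K with coefficients +1 and -1. The identity passes to the
   limit from the left because the signs stabilise, and as K does not vanish identically, F stays bounded
   at points arbitrarily close to its radius of convergence: this is left continuity. The parameters
   with T^k t <= t for all k form a null set, as for t < 1 the survivors miss a dyadic interval. *)

theory Submission
  imports Defs "HOL-Complex_Analysis.Conformal_Mappings"
begin

section \<open>The tent map and dyadic cells\<close>

text \<open>Three kinds of count serve three purposes. Points of the attractor have whole orbits
  below \<open>t\<close>; closed cells with finitely many weak inequalities pass to limits from
  above by compactness; open cells with strict inequalities persist when \<open>t\<close> is lowered
  slightly. They are compared up to factors and sums that no rate above 1 notices, so rates are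
  expressed by the existence of bounds \<open>C * \<beta> ^ n\<close>. The obstacle is the limit
  from the left: a count at \<open>t\<close> is at most the one at some \<open>s < t\<close>, but
  \<open>s\<close> depends on the level, so a constant common to all these \<open>s\<close> is
  wanted. The kneading identity gives it if truncated after \<open>m\<close> signs, because only
  finitely many signs need agree at \<open>s\<close> and \<open>t\<close>, and \<open>m\<close> does
  not depend on the level. The condition that the orbit of \<open>t\<close> stays at most
  \<open>t\<close> keeps it off the turning point 1/2, the only place where a sign can jump. Zeros
  of the limit series must be avoided; they cannot fill an interval because its constant coefficient
  is 1.\<close>

definition tent :: "real \<Rightarrow> real" where
  "tent v = 1 - \<bar>1 - 2 * v\<bar>"

definition surv :: "real \<Rightarrow> nat \<Rightarrow> real \<Rightarrow> bool" where
  "surv t N v \<longleftrightarrow> (\<forall>i<N. (tent ^^ i) v \<le> t)"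

definition cells :: "nat \<Rightarrow> (real \<Rightarrow> bool) \<Rightarrow> nat set" where
  "cells n P = {j. j < 2 ^ n \<and> (\<exists>v. real j \<le> 2 ^ n * v \<and> 2 ^ n * v \<le> real j + 1 \<and> P v)}"

definition exp_bounded :: "(nat \<Rightarrow> nat) \<Rightarrow> real \<Rightarrow> bool" where
  "exp_bounded f \<beta> \<longleftrightarrow> (\<exists>C. \<forall>n. real (f n) \<le> C * \<beta> ^ n)"

lemma tent_bounds: "0 \<le> v \<Longrightarrow> v \<le> 1 \<Longrightarrow> 0 \<le> tent v \<and> tent v \<le> 1"
  by (auto simp: tent_def)

lemma tent_funpow_bounds:
  assumes "0 \<le> v" "v \<le> 1"
  shows "0 \<le> (tent ^^ i) v \<and> (tent ^^ i) v \<le> 1"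
  by (induction i) (use assms tent_bounds in auto)

lemma continuous_on_tent_funpow: "continuous_on UNIV (\<lambda>v. (tent ^^ i) v)"
proof (induction i)
  case (Suc i)
  then show ?case unfolding tent_def funpow.simps o_def
    by (intro continuous_intros) (simp_all add: tent_def[abs_def])
qed simp

lemma isCont_tent_funpow: "isCont (\<lambda>v. (tent ^^ i) v) x"
  using continuous_on_tent_funpow by (simp add: continuous_on_eq_continuous_at)

text \<open>Induction halves the index: \<open>tent ^^ m\<close> is affine on the parent cell
  \<open>k div 2\<close>, and one more tent step folds the half in which the child lies.\<close>

lemma tent_funpow_affine:
  assumes "real k \<le> 2 ^ m * v" "2 ^ m * v \<le> real k + 1" "k < 2 ^ m"
  shows "(tent ^^ m) v = (if even k then 2 ^ m * v - real k else real k + 1 - 2 ^ m * v)"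
  using assms
proof (induction m arbitrary: k)
  case 0
  then show ?case by simp
next
  case (Suc m)
  define k' p where "k' = k div 2" and "p = 2 ^ m * v"
  have k: "k = 2 * k' \<or> k = 2 * k' + 1" unfolding k'_def by linarith
  have p: "real k \<le> 2 * p" "2 * p \<le> real k + 1" using Suc.prems by (simp_all add: p_def)
  have k': "real k' \<le> p" "p \<le> real k' + 1" "k' < 2 ^ m" using k p Suc.prems(3) by auto
  have T: "(tent ^^ m) v = (if even k' then p - real k' else real k' + 1 - p)"
    using Suc.IH[of k'] k' by (simp add: p_def)
  have "tent ((tent ^^ m) v) = (if even k then 2 * p - real k else real k + 1 - 2 * p)"
    unfolding T using k p k' by (cases "even k'") (auto simp: tent_def abs_if)
  then show ?case by (simp add: p_def)
qed

section \<open>Counting dyadic cells\<close>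

lemma finite_cells [simp]: "finite (cells n P)"
  by (rule finite_subset[of _ "{..<2 ^ n}"]) (auto simp: cells_def)

lemma cells_mono: "(\<And>v. P v \<Longrightarrow> Q v) \<Longrightarrow> cells n P \<subseteq> cells n Q"
  unfolding cells_def by blast

lemma card_cells_mono: "(\<And>v. P v \<Longrightarrow> Q v) \<Longrightarrow> card (cells n P) \<le> card (cells n Q)"
  by (intro card_mono cells_mono) auto

lemma card_cells_le: "card (cells n P) \<le> 2 ^ n"
proof -
  have "card (cells n P) \<le> card {..<2 ^ n :: nat}"
    by (intro card_mono) (auto simp: cells_def)
  then show ?thesis by simp
qed

lemma surv_mono: "surv s N v \<Longrightarrow> s \<le> t \<Longrightarrow> M \<le> N \<Longrightarrow> surv t M v"
  unfolding surv_def by (meson less_le_trans order_trans)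

lemma surv_funpow: "surv t (m + N) v \<Longrightarrow> surv t N ((tent ^^ m) v)"
  unfolding surv_def by (metis add.commute add_less_cancel_left comp_apply funpow_add)

lemma div_pow_less: "j < 2 ^ (m + n) \<Longrightarrow> j div 2 ^ n < (2::nat) ^ m"
  by (simp add: div_less_iff_less_mult power_add)

lemma cell_div:
  assumes "real j \<le> 2 ^ (m + n) * v" "2 ^ (m + n) * v \<le> real j + 1"
  shows "real (j div 2 ^ n) \<le> 2 ^ m * v \<and> 2 ^ m * v \<le> real (j div 2 ^ n) + 1"
proof -
  define k r where "k = j div 2 ^ n" and "r = j mod 2 ^ n"
  have j: "j = k * 2 ^ n + r" and "r < 2 ^ n"
    unfolding k_def r_def by (rule div_mult_mod_eq[symmetric], rule mod_less_divisor) simp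
  then have "r + 1 \<le> 2 ^ n" by linarith
  then have "real (r + 1) \<le> real (2 ^ n)" by (rule of_nat_mono)
  then have r: "real r + 1 \<le> 2 ^ n" by simp
  have "real k * 2 ^ n + real r \<le> (2 ^ m * v) * 2 ^ n" "(2 ^ m * v) * 2 ^ n \<le> real k * 2 ^ n + real r + 1"
    using assms by (simp_all add: j power_add mult_ac)
  then have "real k * 2 ^ n \<le> (2 ^ m * v) * 2 ^ n" "(2 ^ m * v) * 2 ^ n \<le> (real k + 1) * 2 ^ n"
    using r unfolding distrib_right by linarith+
  then show ?thesis unfolding k_def[symmetric] by (metis mult_le_cancel_right_pos zero_less_numeral zero_less_power)
qed

text \<open>A cell of level \<open>m + n\<close> is determined by its ancestor of level
  \<open>m\<close> and its image under \<open>tent ^^ m\<close>, a cell of level \<open>n\<close>.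
  The survival time is kept separate from the level because the compactness argument counts points
  that survive longer than the level.\<close>

lemma card_cells_submult:
  "card (cells (m + n) (surv t (m + N))) \<le> card (cells m (surv t (m + N))) * card (cells n (surv t N))"
proof -
  \<comment> \<open>On cells of odd index \<open>tent ^^ m\<close> reverses orientation, hence the
    reflected remainder.\<close>
  define g where "g = (\<lambda>j::nat. (j div 2 ^ n,
    if even (j div 2 ^ n) then j mod 2 ^ n else 2 ^ n - 1 - j mod 2 ^ n))"
  have inj: "inj_on g A" for A
  proof (rule inj_onI)
    fix i j assume "g i = g j"
    moreover have "a = b" if "2 ^ n - 1 - a = 2 ^ n - 1 - b" "a < 2 ^ n" "b < 2 ^ n" for a b :: nat
      using that by linarith
    then have "i mod 2 ^ n = j mod 2 ^ n" if "2 ^ n - 1 - i mod 2 ^ n = 2 ^ n - 1 - j mod 2 ^ n"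
      using that by (meson mod_less_divisor pos2 zero_less_power)
    ultimately have "i div 2 ^ n = j div 2 ^ n \<and> i mod 2 ^ n = j mod 2 ^ n"
      unfolding g_def prod.inject by metis
    then show "i = j" by (metis div_mult_mod_eq)
  qed
  have "g ` cells (m + n) (surv t (m + N)) \<subseteq> cells m (surv t (m + N)) \<times> cells n (surv t N)"
  proof (rule image_subsetI)
    fix j assume "j \<in> cells (m + n) (surv t (m + N))"
    then obtain v where v: "j < 2 ^ (m + n)" "real j \<le> 2 ^ (m + n) * v" "2 ^ (m + n) * v \<le> real j + 1"
      "surv t (m + N) v" by (auto simp: cells_def)
    define k r where "k = j div 2 ^ n" and "r = j mod 2 ^ n"
    have "j = k * 2 ^ n + r" unfolding k_def r_def by (rule div_mult_mod_eq[symmetric])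
    then have j: "real j = real k * 2 ^ n + real r" by simp
    have r: "r < 2 ^ n" by (simp add: r_def)
    have k: "k < 2 ^ m" "real k \<le> 2 ^ m * v" "2 ^ m * v \<le> real k + 1"
      using cell_div[OF v(2,3)] div_pow_less[OF v(1)] by (auto simp: k_def)
    have T: "(tent ^^ m) v = (if even k then 2 ^ m * v - real k else real k + 1 - 2 ^ m * v)"
      using k by (intro tent_funpow_affine)
    have s: "surv t N ((tent ^^ m) v)" using v(4) by (rule surv_funpow)
    have rr: "real (2 ^ n - 1 - r) = 2 ^ n - 1 - real r"
      using r by (simp add: of_nat_diff)
    have "k \<in> cells m (surv t (m + N))" using k v(4) by (auto simp: cells_def)
    moreover have "(if even k then r else 2 ^ n - 1 - r) \<in> cells n (surv t N)"
    proof -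
      have "2 ^ n * (tent ^^ m) v = (if even k then 2 ^ (m + n) * v - real k * 2 ^ n
          else real k * 2 ^ n + 2 ^ n - 2 ^ (m + n) * v)"
        unfolding T by (simp add: power_add algebra_simps)
      then show ?thesis
        unfolding cells_def using r s rr v(2,3) j
        by (auto intro!: exI[of _ "(tent ^^ m) v"])
    qed
    ultimately show "g j \<in> cells m (surv t (m + N)) \<times> cells n (surv t N)"
      by (auto simp: g_def k_def r_def)
  qed
  then have "card (cells (m + n) (surv t (m + N))) \<le> card (cells m (surv t (m + N)) \<times> cells n (surv t N))"
    by (intro card_inj_on_le[OF inj]) auto
  then show ?thesis by (simp add: card_cartesian_product)
qed

lemma card_cells_refine: "card (cells (m + n) P) \<le> card (cells m P) * 2 ^ n"
proof -
  define g where "g = (\<lambda>j::nat. (j div 2 ^ n, j mod 2 ^ n))"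
  have inj: "inj_on g A" for A
    by (rule inj_onI) (metis div_mult_mod_eq g_def prod.inject)
  have "g ` cells (m + n) P \<subseteq> cells m P \<times> {..<2 ^ n}"
    using cell_div div_pow_less by (fastforce simp: cells_def g_def)
  then have "card (cells (m + n) P) \<le> card (cells m P \<times> {..<2 ^ n :: nat})"
    by (intro card_inj_on_le[OF inj]) auto
  then show ?thesis by (simp add: card_cartesian_product)
qed

section \<open>Exponential bounds\<close>

text \<open>One block length suffices: \<open>m\<close> levels are peeled off at a time, and the sum
  \<open>C\<close> covers the levels below \<open>m\<close>.\<close>

lemma exp_boundedI_submult:
  assumes "m > 0" "\<beta> \<ge> 1" "A \<le> \<beta> ^ m" and sub: "\<And>n. real (b (m + n)) \<le> A * real (b n)"
  shows "exp_bounded b \<beta>"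
proof -
  define C where "C = (\<Sum>r<m. real (b r))"
  have C0: "0 \<le> C" by (simp add: C_def sum_nonneg)
  have "real (b n) \<le> C * \<beta> ^ n" for n
  proof (induction n rule: less_induct)
    case (less n)
    show ?case
    proof (cases "n < m")
      case True
      then have "real (b n) \<le> C" unfolding C_def by (intro member_le_sum) auto
      also have "C \<le> C * \<beta> ^ n" using C0 one_le_power[OF assms(2), of n] by (simp add: mult_le_cancel_left1)
      finally show ?thesis .
    next
      case False
      then have n: "n = m + (n - m)" by simp
      have "real (b n) \<le> A * real (b (n - m))" using sub[of "n - m"] n by simp
      also have "\<dots> \<le> \<beta> ^ m * (C * \<beta> ^ (n - m))"
        using less[of "n - m"] False assms by (intro mult_mono) auto
      also have "\<dots> = C * \<beta> ^ n" by (subst (2) n) (simp add: power_add)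
      finally show ?thesis .
    qed
  qed
  then show ?thesis by (auto simp: exp_bounded_def)
qed

lemma exp_bounded_le: 
  assumes "exp_bounded g \<beta>" "\<And>n. f n \<le> g n"
  shows "exp_bounded f \<beta>"
proof -
  obtain C where "\<And>n. real (g n) \<le> C * \<beta> ^ n" using assms(1) by (auto simp: exp_bounded_def)
  then show ?thesis using assms(2) unfolding exp_bounded_def by (meson of_nat_mono order_trans)
qed

lemma exp_bounded_const_nonneg:
  assumes "exp_bounded f \<beta>"
  obtains C where "C \<ge> 0" "\<And>n. real (f n) \<le> C * \<beta> ^ n"
proof -
  obtain C where C: "\<And>n. real (f n) \<le> C * \<beta> ^ n" using assms by (auto simp: exp_bounded_def)
  moreover have "0 \<le> C" using C[of 0] by (simp add: order_trans[of 0 "real (f 0)"])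
  ultimately show ?thesis using that by blast
qed

lemma exp_bounded_mono:
  assumes "exp_bounded f \<beta>" "0 \<le> \<beta>" "\<beta> \<le> \<gamma>"
  shows "exp_bounded f \<gamma>"
proof -
  obtain C where "C \<ge> 0" "\<And>n. real (f n) \<le> C * \<beta> ^ n" using exp_bounded_const_nonneg[OF assms(1)] by blast
  moreover have "C * \<beta> ^ n \<le> C * \<gamma> ^ n" for n using \<open>C \<ge> 0\<close> assms by (intro mult_left_mono power_mono) auto
  ultimately show ?thesis unfolding exp_bounded_def by (meson order_trans)
qed

text \<open>A fixed delay \<open>n\<close> costs only a constant; \<open>D\<close> absorbs the first
  \<open>n\<close> values.\<close>

lemma exp_bounded_shift:
  assumes g: "exp_bounded g \<beta>" and "1 \<le> \<beta>" and f: "\<And>m. f (m + n) \<le> c * g m"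
  shows "exp_bounded f \<beta>"
proof -
  obtain C where C: "C \<ge> 0" "\<And>n. real (g n) \<le> C * \<beta> ^ n" using exp_bounded_const_nonneg[OF g] by blast
  define D where "D = (\<Sum>k<n. real (f k))"
  have D: "D \<ge> 0" by (simp add: D_def sum_nonneg)
  have "real (f k) \<le> (D + real c * C) * \<beta> ^ k" for k
  proof (cases "k < n")
    case True
    have "real (f k) \<le> D" unfolding D_def using True by (intro member_le_sum) auto
    also have "\<dots> \<le> (D + real c * C) * 1" using C by simp
    also have "\<dots> \<le> (D + real c * C) * \<beta> ^ k"
      using C D assms(2) by (intro mult_left_mono one_le_power) auto
    finally show ?thesis .
  next
    case False
    then obtain m where k: "k = m + n" by (metis add.commute le_add_diff_inverse not_less)
    have "real (f k) \<le> real (c * g m)" using f by (simp only: k of_nat_mono)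
    also have "\<dots> \<le> real c * (C * \<beta> ^ m)" using C(2)[of m] by (simp add: mult_left_mono)
    also have "\<dots> = real c * C * \<beta> ^ m" by simp
    also have "\<dots> \<le> (D + real c * C) * \<beta> ^ k"
      using C D assms(2) by (intro mult_mono power_increasing) (auto simp: k)
    finally show ?thesis .
  qed
  then show ?thesis unfolding exp_bounded_def by blast
qed

lemma exp_bounded_cells_surv:
  assumes "m > 0" "\<beta> \<ge> 1" "real (card (cells m (surv t m))) \<le> \<beta> ^ m"
  shows "exp_bounded (\<lambda>n. card (cells n (surv t n))) \<beta>"
proof (rule exp_boundedI_submult[OF assms])
  fix n
  have "card (cells (m + n) (surv t (m + n))) \<le> card (cells m (surv t (m + n))) * card (cells n (surv t n))"
    by (rule card_cells_submult)
  also have "\<dots> \<le> card (cells m (surv t m)) * card (cells n (surv t n))"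
    by (intro mult_right_mono card_cells_mono) (auto elim: surv_mono)
  finally show "real (card (cells (m + n) (surv t (m + n)))) \<le> real (card (cells m (surv t m))) * real (card (cells n (surv t n)))"
    by (simp flip: of_nat_mult)
qed

text \<open>Inside one cell the survivors form nested compact sets, whose common points have their
  whole orbit at most \<open>t\<close>. There are finitely many cells of level \<open>m\<close>, so
  one \<open>N\<close> serves all. A single index drives both threshold and time to make the sets
  nested.\<close>

lemma cells_surv_compact:
  "\<exists>N. cells m (surv (t + 1 / (real N + 1)) N) \<subseteq> cells m (\<lambda>v. \<forall>i. (tent ^^ i) v \<le> t)"
proof -
  define W where "W = cells m (\<lambda>v. \<forall>i. (tent ^^ i) v \<le> t)"
  let ?V = "\<lambda>N. cells m (surv (t + 1 / (real N + 1)) N)"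
  have anti: "?V N' \<subseteq> ?V N" if "N \<le> N'" for N N'
    using that by (intro cells_mono) (erule surv_mono, auto simp: frac_le)
  have "\<exists>N. j \<notin> ?V N" if j: "j < 2 ^ m" "j \<notin> W" for j
  proof (rule ccontr)
    assume "\<nexists>N. j \<notin> ?V N"
    then have all: "j \<in> ?V N" for N by blast
    define F where "F = (\<lambda>N. {real j / 2 ^ m .. (real j + 1) / 2 ^ m} \<inter> {v. surv (t + 1 / (real N + 1)) N v})"
    have eq: "v \<in> {real j / 2 ^ m .. (real j + 1) / 2 ^ m} \<longleftrightarrow> real j \<le> 2 ^ m * v \<and> 2 ^ m * v \<le> real j + 1" for v
      by (auto simp: field_simps)
    have "closed {v. surv s N v}" for s N
    proof -
      have "{v. surv s N v} = (\<Inter>i\<in>{..<N}. {v. (tent ^^ i) v \<le> s})" by (auto simp: surv_def)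
      also have "closed \<dots>" by (intro closed_INT ballI closed_Collect_le continuous_on_tent_funpow continuous_on_const)
      finally show ?thesis .
    qed
    then have "compact (F N)" for N unfolding F_def by (intro compact_Int_closed) auto
    moreover have "F N \<noteq> {}" for N
      using all[of N] eq unfolding cells_def F_def by blast
    moreover have "F N' \<subseteq> F N" if "N \<le> N'" for N N'
      using that unfolding F_def by (auto elim!: surv_mono simp: frac_le)
    ultimately have "(\<Inter>N. F N) \<noteq> {}" by (intro compact_nest) auto
    then obtain v where v: "\<And>N. v \<in> F N" by blast
    have "(tent ^^ i) v \<le> t" for i
    proof (rule LIMSEQ_le_const)
      have "(\<lambda>N. t + 1 / (real N + 1)) \<longlonglongrightarrow> t + 0"
        by (intro tendsto_add tendsto_const) (use LIMSEQ_inverse_real_of_nat in \<open>simp add: inverse_eq_divide add.commute\<close>)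
      then show "(\<lambda>N. t + 1 / (real N + 1)) \<longlonglongrightarrow> t" by simp
      show "\<exists>N. \<forall>n\<ge>N. (tent ^^ i) v \<le> t + 1 / (real n + 1)"
        using v by (intro exI[of _ "Suc i"]) (auto simp: F_def surv_def)
    qed
    moreover have "real j \<le> 2 ^ m * v \<and> 2 ^ m * v \<le> real j + 1" using v[of 0] eq by (auto simp: F_def)
    ultimately have "j \<in> W" using j(1) by (auto simp: W_def cells_def)
    with j show False by simp
  qed
  then obtain f where f: "\<And>j. j < 2 ^ m \<Longrightarrow> j \<notin> W \<Longrightarrow> j \<notin> ?V (f j)" by metis
  define N where "N = Max (f ` {..<2 ^ m})"
  have "?V N \<subseteq> W"
  proof
    fix j assume j: "j \<in> ?V N"
    then have lt: "j < 2 ^ m" by (simp add: cells_def)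
    then have "f j \<le> N" by (simp add: N_def)
    then have "j \<in> ?V (f j)" using anti j by blast
    then show "j \<in> W" using f lt by blast
  qed
  then show ?thesis unfolding W_def by blast
qed

text \<open>Serves twice: for right continuity of the growth rate, and to return from whole orbits,
  which the attractor provides, to finite survival times.\<close>

lemma exp_bounded_surv_above:
  assumes W: "exp_bounded (\<lambda>n. card (cells n (\<lambda>v. \<forall>i. (tent ^^ i) v \<le> t))) \<beta>"
    and "1 \<le> \<beta>" "\<beta> < \<gamma>"
  shows "\<exists>s>t. exp_bounded (\<lambda>n. card (cells n (surv s n))) \<gamma>"
proof -
  let ?W = "\<lambda>n. cells n (\<lambda>v. \<forall>i. (tent ^^ i) v \<le> t)"
  obtain C where C: "C \<ge> 0" "\<And>n. real (card (?W n)) \<le> C * \<beta> ^ n"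
    using exp_bounded_const_nonneg[OF W] by blast
  \<comment> \<open>The gap between \<open>\<beta>\<close> and \<open>\<gamma>\<close> swallows the
    constant \<open>C\<close> at a large level; \<open>Suc\<close> makes that level
    positive.\<close>
  obtain m0 where "C < (\<gamma> / \<beta>) ^ m0" using real_arch_pow[of "\<gamma> / \<beta>" C] assms by auto
  also have "\<dots> \<le> (\<gamma> / \<beta>) ^ Suc m0" using assms by (intro power_increasing) auto
  finally obtain m where m: "m > 0" "C < (\<gamma> / \<beta>) ^ m" by blast
  then have "C * \<beta> ^ m < \<gamma> ^ m" using assms by (simp add: field_simps)
  then have Wm: "real (card (?W m)) \<le> \<gamma> ^ m" using C(2)[of m] by linarith
  obtain N where N: "cells m (surv (t + 1 / (real N + 1)) N) \<subseteq> ?W m" using cells_surv_compact by blast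
  define s where "s = t + 1 / (real N + 1)"
  \<comment> \<open>The \<open>N\<close> extra steps ensure, for every \<open>n\<close>, that the
    ancestors of level \<open>m\<close> lie in \<open>?W m\<close>.\<close>
  define b where "b = (\<lambda>n. card (cells n (surv s (n + N))))"
  have "real (b (m + n)) \<le> real (card (?W m)) * real (b n)" for n
  proof -
    have "b (m + n) \<le> card (cells m (surv s (m + (n + N)))) * b n"
      using card_cells_submult[of m n s "n + N"] by (simp add: b_def add.assoc)
    also have "cells m (surv s (m + (n + N))) \<subseteq> cells m (surv s N)"
      by (intro cells_mono) (auto elim: surv_mono)
    then have "card (cells m (surv s (m + (n + N)))) \<le> card (?W m)"
      using N by (intro card_mono) (auto simp: s_def)
    finally show ?thesis by (simp flip: of_nat_mult)
  qed
  then have "exp_bounded b \<gamma>" using assms m Wm by (intro exp_boundedI_submult[of m _ "real (card (?W m))"]) auto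
  then have "exp_bounded (\<lambda>n. card (cells n (surv s n))) \<gamma>"
  proof (rule exp_bounded_shift)
    show "card (cells (n + N) (surv s (n + N))) \<le> 2 ^ N * b n" for n
      using card_cells_refine[of n N "surv s (n + N)"] by (simp add: b_def mult.commute)
  qed (use assms in simp)
  moreover have "s > t" by (simp add: s_def)
  ultimately show ?thesis by blast
qed

section \<open>Open cells\<close>

text \<open>Strict inequalities make survival to a finite time an open condition in both
  \<open>v\<close> and \<open>t\<close>, and a point lies in at most one open cell of each level, so
  a cut at a point disturbs at most one cell.\<close>

definition strict_surv :: "real \<Rightarrow> nat \<Rightarrow> real \<Rightarrow> bool" where
  "strict_surv t N v \<longleftrightarrow> (\<forall>i<N. (tent ^^ i) v < t)"

definition open_cells :: "nat \<Rightarrow> (real \<Rightarrow> bool) \<Rightarrow> nat set" where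
  "open_cells n P = {j. j < 2 ^ n \<and> (\<exists>v. real j < 2 ^ n * v \<and> 2 ^ n * v < real j + 1 \<and> P v)}"

lemma finite_open_cells [simp]: "finite (open_cells n P)"
  by (rule finite_subset[of _ "{..<2 ^ n}"]) (auto simp: open_cells_def)

lemma strict_surv_imp_surv: "strict_surv t N v \<Longrightarrow> surv t N v"
  by (auto simp: surv_def strict_surv_def less_imp_le)

lemma open_cells_subset_cells: "open_cells n (strict_surv t n) \<subseteq> cells n (surv t n)"
  unfolding open_cells_def cells_def by (auto intro: less_imp_le strict_surv_imp_surv)

lemma strict_surv_Suc: "strict_surv t (Suc n) v \<longleftrightarrow> v < t \<and> strict_surv t n (tent v)"
  unfolding strict_surv_def by (simp add: All_less_Suc2 funpow_Suc_right del: funpow.simps)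

text \<open>Strict survivors form an open set, so one at the boundary of a cell has others nearby in
  the interior.\<close>

lemma open_cellsI_perturb:
  assumes j: "j < 2 ^ n" and v: "real j \<le> 2 ^ n * v" "2 ^ n * v \<le> real j + 1" "strict_surv t N v"
  shows "j \<in> open_cells n (strict_surv t N)"
proof -
  define I U where "I = {real j / 2 ^ n <..< (real j + 1) / 2 ^ n}" and "U = {v. strict_surv t N v}"
  have "U = (\<Inter>i\<in>{..<N}. {v. (tent ^^ i) v < t})" by (auto simp: U_def strict_surv_def)
  also have "open \<dots>"
    by (intro open_INT ballI open_Collect_less continuous_on_tent_funpow continuous_on_const) auto
  finally have "open U" .
  have "closure I = {real j / 2 ^ n .. (real j + 1) / 2 ^ n}"
    unfolding I_def by (intro closure_greaterThanLessThan) (simp add: divide_strict_right_mono)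
  then have "v \<in> closure I" using v by (auto simp: field_simps)
  moreover have "v \<in> U" using v by (simp add: U_def)
  ultimately have "U \<inter> I \<noteq> {}" using open_Int_closure_eq_empty[OF \<open>open U\<close>, of I] by blast
  then obtain w where "w \<in> I" "strict_surv t N w" by (auto simp: U_def)
  then show ?thesis using j by (auto simp: open_cells_def I_def field_simps intro!: exI[of _ w])
qed

text \<open>A survivor that reaches the bound \<open>t\<close>, for the first time at time \<open>k\<close>, is determined by its open
  cell of level \<open>k\<close>, since the branch of \<open>T\<^sup>k\<close> there is injective.\<close>

lemma card_cells_le_open_cells:
  "card (cells n (surv t n)) \<le>
     card (open_cells n (strict_surv t n)) + (\<Sum>k<n. 2 * card (open_cells k (strict_surv t k)))"
proof -
  define J where "J = (\<lambda>k j'. {j :: nat. \<exists>v. real j \<le> 2 ^ n * v \<and> 2 ^ n * v \<le> real j + 1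
    \<and> real j' \<le> 2 ^ k * v \<and> 2 ^ k * v \<le> real j' + 1 \<and> (tent ^^ k) v = t})"
  have J: "finite (J k j') \<and> card (J k j') \<le> 2" if "j' < 2 ^ k" for k j'
  proof -
    \<comment> \<open>The only candidate in cell \<open>j'\<close> for a point sent to
      \<open>t\<close>; a point meets at most two closed cells of level \<open>n\<close>.\<close>
    define v0 where "v0 = (if even j' then (t + real j') / 2 ^ k else (real j' + 1 - t) / 2 ^ k)"
    have "j \<in> {nat \<lfloor>2 ^ n * v0\<rfloor>, nat (\<lfloor>2 ^ n * v0\<rfloor> - 1)}" if j: "j \<in> J k j'" for j
    proof -
      obtain v where v: "real j \<le> 2 ^ n * v" "2 ^ n * v \<le> real j + 1" "real j' \<le> 2 ^ k * v"
        "2 ^ k * v \<le> real j' + 1" "(tent ^^ k) v = t" using j by (auto simp: J_def)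
      have "v = v0" using tent_funpow_affine[OF v(3,4) \<open>j' < 2 ^ k\<close>] v(5)
        by (auto simp: v0_def field_simps split: if_splits)
      then have "real j \<le> 2 ^ n * v0" "2 ^ n * v0 \<le> real j + 1" using v(1,2) by auto
      then have "\<lfloor>2 ^ n * v0\<rfloor> = int j \<or> \<lfloor>2 ^ n * v0\<rfloor> = int j + 1" by linarith
      then show ?thesis by auto
    qed
    then have "J k j' \<subseteq> {nat \<lfloor>2 ^ n * v0\<rfloor>, nat (\<lfloor>2 ^ n * v0\<rfloor> - 1)}" by blast
    moreover have "card {nat \<lfloor>2 ^ n * v0\<rfloor>, nat (\<lfloor>2 ^ n * v0\<rfloor> - 1)} \<le> 2"
      by (simp add: card_insert_if)
    ultimately show ?thesis by (meson card_mono finite.intros finite_subset order_trans)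
  qed
  have "cells n (surv t n) \<subseteq> open_cells n (strict_surv t n) \<union>
      (\<Union>k\<in>{..<n}. \<Union>j'\<in>open_cells k (strict_surv t k). J k j')"
  proof
    fix j assume "j \<in> cells n (surv t n)"
    then obtain v where v: "j < 2 ^ n" "real j \<le> 2 ^ n * v" "2 ^ n * v \<le> real j + 1" "surv t n v"
      by (auto simp: cells_def)
    show "j \<in> open_cells n (strict_surv t n) \<union>
      (\<Union>k\<in>{..<n}. \<Union>j'\<in>open_cells k (strict_surv t k). J k j')"
    proof (cases "strict_surv t n v")
      case True
      then show ?thesis using open_cellsI_perturb v by blast
    next
      case False
      then have ex: "\<exists>k. k < n \<and> (tent ^^ k) v = t"
        using v(4) by (auto simp: strict_surv_def surv_def not_less intro: antisym)
      define k where "k = (LEAST k. k < n \<and> (tent ^^ k) v = t)"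
      have k: "k < n" "(tent ^^ k) v = t" using LeastI_ex[OF ex] by (auto simp: k_def)
      have ss: "strict_surv t k v"
        using v(4) k(1) not_less_Least[of _ "\<lambda>k. k < n \<and> (tent ^^ k) v = t"]
        unfolding strict_surv_def surv_def k_def[symmetric] by (metis less_trans order_le_less)
      define j' where "j' = j div 2 ^ (n - k)"
      have nk: "n = k + (n - k)" using k(1) by simp
      have "real j' \<le> 2 ^ k * v" "2 ^ k * v \<le> real j' + 1"
        using cell_div[of j k "n - k" v] v(2,3) nk by (auto simp: j'_def)
      moreover have "j' < 2 ^ k" using div_pow_less[of j k "n - k"] v(1) nk by (simp add: j'_def)
      ultimately have "j' \<in> open_cells k (strict_surv t k)" "j \<in> J k j'"
        using open_cellsI_perturb ss v k by (auto simp: J_def)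
      then show ?thesis using k(1) by blast
    qed
  qed
  moreover have fin: "finite (\<Union>k\<in>{..<n}. \<Union>j'\<in>open_cells k (strict_surv t k). J k j')"
    using J by (auto simp: open_cells_def)
  ultimately have "card (cells n (surv t n)) \<le> card (open_cells n (strict_surv t n) \<union>
      (\<Union>k\<in>{..<n}. \<Union>j'\<in>open_cells k (strict_surv t k). J k j'))"
    by (intro card_mono) auto
  also have "\<dots> \<le> card (open_cells n (strict_surv t n)) +
      card (\<Union>k\<in>{..<n}. \<Union>j'\<in>open_cells k (strict_surv t k). J k j')"
    by (rule card_Un_le)
  also have "card (\<Union>k\<in>{..<n}. \<Union>j'\<in>open_cells k (strict_surv t k). J k j') \<le>
      (\<Sum>k<n. card (\<Union>j'\<in>open_cells k (strict_surv t k). J k j'))"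
    by (rule card_UN_le) auto
  also have "\<dots> \<le> (\<Sum>k<n. 2 * card (open_cells k (strict_surv t k)))"
  proof (rule sum_mono)
    fix k
    have "card (\<Union>j'\<in>open_cells k (strict_surv t k). J k j') \<le> (\<Sum>j'\<in>open_cells k (strict_surv t k). card (J k j'))"
      by (rule card_UN_le) auto
    also have "\<dots> \<le> (\<Sum>j'\<in>open_cells k (strict_surv t k). 2)"
      using J by (intro sum_mono) (auto simp: open_cells_def)
    finally show "card (\<Union>j'\<in>open_cells k (strict_surv t k). J k j') \<le> 2 * card (open_cells k (strict_surv t k))"
      by (simp add: mult.commute)
  qed
  finally show ?thesis by simp
qed

lemma sum_power_le:
  fixes \<beta> :: real
  assumes "\<beta> > 1"
  shows "(\<Sum>k<n. \<beta> ^ k) \<le> \<beta> ^ n / (\<beta> - 1)"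
  using assms geometric_sum[of \<beta> n] by (simp add: divide_right_mono)

text \<open>For \<open>\<beta> > 1\<close> a geometric sum is comparable with its last term.\<close>

lemma exp_bounded_sum:
  assumes g: "exp_bounded g \<beta>" and "\<beta> > 1" and f: "\<And>n. f n \<le> c * g n + (\<Sum>k<n. d * g k)"
  shows "exp_bounded f \<beta>"
proof -
  obtain C where C: "C \<ge> 0" "\<And>n. real (g n) \<le> C * \<beta> ^ n" using exp_bounded_const_nonneg[OF g] by blast
  have "real (f n) \<le> (c * C + d * C / (\<beta> - 1)) * \<beta> ^ n" for n
  proof -
    have "real (f n) \<le> real (c * g n + (\<Sum>k<n. d * g k))" using f by (intro of_nat_mono)
    also have "\<dots> = c * real (g n) + d * (\<Sum>k<n. real (g k))" by (simp add: sum_distrib_left)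
    also have "\<dots> \<le> c * (C * \<beta> ^ n) + d * (\<Sum>k<n. C * \<beta> ^ k)"
      by (intro add_mono mult_left_mono sum_mono C) auto
    also have "\<dots> = c * (C * \<beta> ^ n) + d * (C * (\<Sum>k<n. \<beta> ^ k))" by (simp add: sum_distrib_left)
    also have "\<dots> \<le> c * (C * \<beta> ^ n) + d * (C * (\<beta> ^ n / (\<beta> - 1)))"
      by (intro add_left_mono mult_left_mono sum_power_le C assms) auto
    finally show ?thesis by (simp add: algebra_simps)
  qed
  then show ?thesis unfolding exp_bounded_def by blast
qed

lemma exp_bounded_open_cells:
  assumes "exp_bounded (\<lambda>n. card (open_cells n (strict_surv t n))) \<beta>" "\<beta> > 1"
  shows "exp_bounded (\<lambda>n. card (cells n (surv t n))) \<beta>"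
  using card_cells_le_open_cells by (intro exp_bounded_sum[OF assms, of _ 1 2]) simp

section \<open>The kneading identity\<close>

text \<open>The orbit is taken under the truncated map \<open>min T t\<close>. This makes the identity valid for every \<open>t\<close>,
  also when the orbit of \<open>t\<close> under the tent map exceeds \<open>t\<close>.\<close>

primrec tau :: "real \<Rightarrow> nat \<Rightarrow> real" where
  "tau t 0 = t"
| "tau t (Suc k) = min (tent (tau t k)) t"

text \<open>The sign of the slope of the tent map; at 1/2 it follows the left branch, in agreement
  with \<open>cnt_left\<close>.\<close>

definition eps :: "real \<Rightarrow> real" where
  "eps y = (if y \<le> 1/2 then 1 else -1)"

text \<open>The accumulated orientations along the orbit: the coefficients of the Milnor-Thurston
  kneading series.\<close>

definition theta :: "real \<Rightarrow> nat \<Rightarrow> real" where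
  "theta t k = (\<Prod>j<k. eps (tau t j))"

text \<open>A distribution function of the surviving cells; the branches of the tent map yield a
  recursion that moves the cut point \<open>y\<close> along its orbit.\<close>

definition cnt :: "real \<Rightarrow> nat \<Rightarrow> real \<Rightarrow> nat" where
  "cnt t n y = card (open_cells n (\<lambda>v. v < y \<and> strict_surv t n v))"

abbreviation strict_count :: "real \<Rightarrow> nat \<Rightarrow> nat" where
  "strict_count t n \<equiv> card (open_cells n (strict_surv t n))"

lemma open_cells_0: "open_cells 0 P = (if \<exists>v>0. v < 1 \<and> P v then {0} else {})"
  by (auto simp: open_cells_def)

lemma cnt_le: "cnt t n y \<le> strict_count t n"
  unfolding cnt_def by (intro card_mono) (auto simp: open_cells_def)

text \<open>On the left branch the tent map is multiplication by 2 and keeps the cell index; the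
  additional survival condition holds because \<open>v < 1/2 < t\<close>.\<close>

lemma cnt_left:
  assumes "y \<le> 1/2" "1/2 < t"
  shows "cnt t (Suc n) y = cnt t n (2 * y)"
proof -
  have "open_cells (Suc n) (\<lambda>v. v < y \<and> strict_surv t (Suc n) v) =
    open_cells n (\<lambda>v. v < 2 * y \<and> strict_surv t n v)" (is "?A = ?B")
  proof (rule set_eqI)
    fix j
    have pos: "0 < v" if "real j < 2 ^ n * v" for v
      using that by (metis less_le_trans mult_le_0_iff not_less of_nat_0_le_iff zero_le_numeral zero_le_power order.asym)
    show "j \<in> ?A \<longleftrightarrow> j \<in> ?B"
    proof
      assume "j \<in> ?A"
      then obtain v where v: "real j < 2 ^ n * (2 * v)" "2 ^ n * (2 * v) < real j + 1" "v < y"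
        "strict_surv t (Suc n) v" by (auto simp: open_cells_def mult_ac)
      have "tent v = 2 * v" using v(3) assms by (simp add: tent_def)
      then have "strict_surv t n (2 * v)" using v(4) by (simp add: strict_surv_Suc)
      moreover have "2 ^ n * (2 * v) < 2 ^ n * 1" using v(3) assms by (intro mult_strict_left_mono) auto
      then have "real j < real (2 ^ n)" unfolding of_nat_power of_nat_numeral using v(1) by linarith
      then have "j < 2 ^ n" by (simp only: of_nat_less_iff)
      ultimately show "j \<in> ?B" using v unfolding open_cells_def by (auto intro!: exI[of _ "2 * v"])
    next
      assume "j \<in> ?B"
      then obtain v where v: "real j < 2 ^ n * v" "2 ^ n * v < real j + 1" "v < 2 * y"
        "strict_surv t n v" "j < 2 ^ n" by (auto simp: open_cells_def)
      have "tent (v / 2) = v" using v(3) assms by (simp add: tent_def)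
      then have "strict_surv t (Suc n) (v / 2)" using v(3,4) assms by (simp add: strict_surv_Suc)
      then show "j \<in> ?A" using v unfolding open_cells_def by (auto intro!: exI[of _ "v / 2"])
    qed
  qed
  then show ?thesis by (simp add: cnt_def)
qed

text \<open>The error accounts for the one cell that may contain the cut point \<open>2 - 2 * y\<close>.\<close>

lemma cnt_right:
  assumes "1/2 < y" "y \<le> t"
  shows "\<bar>real (cnt t (Suc n) y) - (2 * real (strict_count t n) - real (cnt t n (2 - 2 * y)))\<bar> \<le> 1"
proof -
  define u where "u = 2 - 2 * y"
  define A where "A = open_cells (Suc n) (\<lambda>v. v < y \<and> strict_surv t (Suc n) v)"
  define B where "B = open_cells n (\<lambda>v. u < v \<and> strict_surv t n v)"
  define A1 where "A1 = open_cells n (\<lambda>v. v < u \<and> strict_surv t n v)"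
  define All where "All = open_cells n (strict_surv t n)"
  \<comment> \<open>The one cell with the cut point in its interior: the estimate allows for its
    being counted on both sides of the cut or on neither.\<close>
  define S where "S = {j. real j < 2 ^ n * u \<and> 2 ^ n * u < real j + 1}"
  have ub: "v < 1/2" if "j < 2 ^ n" "2 ^ Suc n * v < real j + 1" for j :: nat and v :: real
  proof -
    have "j + 1 \<le> 2 ^ n" using that by simp
    then have "real (j + 1) \<le> real (2 ^ n)" by (rule of_nat_mono)
    moreover have "2 ^ n * (2 * v) = 2 ^ Suc n * v" by simp
    ultimately have "2 ^ n * (2 * v) < 2 ^ n * 1" using that
      unfolding of_nat_add of_nat_power of_nat_numeral of_nat_1 by linarith
    then show ?thesis by simp
  qed
  have L: "A \<inter> {..<2 ^ n} = All"
  proof (rule set_eqI)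
    fix j
    show "j \<in> A \<inter> {..<2 ^ n} \<longleftrightarrow> j \<in> All"
    proof
      assume "j \<in> A \<inter> {..<2 ^ n}"
      then obtain v where v: "real j < 2 ^ Suc n * v" "2 ^ Suc n * v < real j + 1"
        "strict_surv t (Suc n) v" "j < 2 ^ n" unfolding A_def open_cells_def by blast
      have "tent v = 2 * v" using ub[OF v(4,2)] by (simp add: tent_def)
      then show "j \<in> All" using v unfolding All_def open_cells_def
        by (auto simp: strict_surv_Suc intro!: exI[of _ "2 * v"])
    next
      assume "j \<in> All"
      then obtain v where v: "real j < 2 ^ n * v" "2 ^ n * v < real j + 1" "strict_surv t n v" "j < 2 ^ n"
        by (auto simp: All_def open_cells_def)
      have h: "v / 2 < 1/2" using ub[OF v(4), of "v / 2"] v(2) by simp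
      then have "tent (v / 2) = v" by (simp add: tent_def)
      then have "strict_surv t (Suc n) (v / 2)" using h v(3) assms by (simp add: strict_surv_Suc)
      then show "j \<in> A \<inter> {..<2 ^ n}" using v h assms unfolding A_def open_cells_def
        by (auto intro!: exI[of _ "v / 2"])
    qed
  qed
  have half: "1/2 < v" if "2 ^ n \<le> j" "real j < 2 ^ Suc n * v" for j :: nat and v :: real
  proof -
    have "real (2 ^ n) \<le> real j" using that by (intro of_nat_mono)
    moreover have "2 ^ n * (2 * v) = 2 ^ Suc n * v" by simp
    ultimately have "2 ^ n * 1 < 2 ^ n * (2 * v)"
      using that unfolding of_nat_power of_nat_numeral by linarith
    then show ?thesis by simp
  qed
  \<comment> \<open>The right branch reverses orientation, so the index is reflected;
    \<open>g\<close> is its own inverse on indices below \<open>2 ^ Suc n\<close>.\<close>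
  define g :: "nat \<Rightarrow> nat" where "g = (\<lambda>j. 2 ^ Suc n - 1 - j)"
  have greal: "real (g j) = 2 ^ Suc n - 1 - real j" if "j < 2 ^ Suc n" for j
    using that unfolding g_def by (simp add: of_nat_diff)
  have "bij_betw g (A \<inter> {2 ^ n..}) B"
  proof (rule bij_betw_byWitness[where f' = g])
    show "\<forall>j\<in>A \<inter> {2 ^ n..}. g (g j) = j" by (auto simp: A_def open_cells_def g_def)
    show "\<forall>j\<in>B. g (g j) = j" by (auto simp: B_def open_cells_def g_def)
    show "g ` (A \<inter> {2 ^ n..}) \<subseteq> B"
    proof (rule image_subsetI)
      fix j assume "j \<in> A \<inter> {2 ^ n..}"
      then obtain v where v: "real j < 2 ^ Suc n * v" "2 ^ Suc n * v < real j + 1" "v < y"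
        "strict_surv t (Suc n) v" "2 ^ n \<le> j" "j < 2 ^ Suc n" unfolding A_def open_cells_def by blast
      have "tent v = 2 - 2 * v" using half[OF v(5,1)] by (simp add: tent_def)
      then have "strict_surv t n (2 - 2 * v)" "u < 2 - 2 * v" using v by (auto simp: strict_surv_Suc u_def)
      moreover have "g j < 2 ^ n" using v(5) zero_less_power[of "2::nat" n] unfolding g_def power_Suc by linarith
      moreover have "2 ^ n * (2 - 2 * v) = 2 ^ Suc n - 2 ^ Suc n * v" by (simp add: algebra_simps)
      ultimately show "g j \<in> B" using v greal[OF v(6)] unfolding B_def open_cells_def
        by (intro CollectI conjI exI[of _ "2 - 2 * v"]) linarith+
    qed
    show "g ` B \<subseteq> A \<inter> {2 ^ n..}"
    proof (rule image_subsetI)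
      fix j assume "j \<in> B"
      then obtain v where v: "real j < 2 ^ n * v" "2 ^ n * v < real j + 1" "u < v"
        "strict_surv t n v" "j < 2 ^ n" by (auto simp: B_def open_cells_def)
      have "v / 2 < 1/2" using ub[OF v(5), of "v / 2"] v(2) by simp
      then have "tent (1 - v / 2) = v" by (simp add: tent_def)
      then have "strict_surv t (Suc n) (1 - v / 2)" "1 - v / 2 < y" using v assms by (auto simp: strict_surv_Suc u_def)
      moreover have "g j < 2 ^ Suc n" "2 ^ n \<le> g j" "j < 2 ^ Suc n" using v(5) unfolding g_def by auto
      moreover have "2 ^ Suc n * (1 - v / 2) = 2 ^ Suc n - 2 ^ n * v" by (simp add: algebra_simps)
      ultimately show "g j \<in> A \<inter> {2 ^ n..}" using v(1,2) greal[of j] unfolding A_def open_cells_def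
        by (intro IntI CollectI conjI exI[of _ "1 - v / 2"]) (assumption | simp)+
    qed
  qed
  then have R: "card (A \<inter> {2 ^ n..}) = card B" by (rule bij_betw_same_card)
  have "finite A" by (simp add: A_def)
  moreover have "A = (A \<inter> {..<2 ^ n}) \<union> (A \<inter> {2 ^ n..})" "(A \<inter> {..<2 ^ n}) \<inter> (A \<inter> {2 ^ n..}) = {}" by auto
  ultimately have cA: "card A = card All + card B"
    using card_Un_disjoint[of "A \<inter> {..<2 ^ n}" "A \<inter> {2 ^ n..}"] L R by (metis finite_Int)
  have "S \<subseteq> {nat \<lfloor>2 ^ n * u\<rfloor>}" unfolding S_def by (auto simp: floor_eq_iff) linarith
  then have S: "finite S" "card S \<le> 1" using card_mono[of "{nat \<lfloor>2 ^ n * u\<rfloor>}" S] by (auto intro: finite_subset)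
  have fin: "finite B" "finite A1" "finite All" by (simp_all add: B_def A1_def All_def)
  have "card B + card A1 = card (B \<union> A1) + card (B \<inter> A1)" using card_Un_Int fin by auto
  moreover have "card (B \<union> A1) \<le> card All"
    using fin by (intro card_mono) (auto simp: B_def A1_def All_def open_cells_def)
  moreover have "B \<inter> A1 \<subseteq> S"
  proof
    fix j assume "j \<in> B \<inter> A1"
    then obtain v w where "real j < 2 ^ n * v" "v < u" "2 ^ n * w < real j + 1" "u < w"
      by (auto simp: B_def A1_def open_cells_def)
    moreover from this have "2 ^ n * v < 2 ^ n * u" "2 ^ n * u < 2 ^ n * w" by simp_all
    ultimately show "j \<in> S" unfolding S_def mem_Collect_eq by linarith
  qed
  then have "card (B \<inter> A1) \<le> 1" using S card_mono le_trans by blast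
  moreover have "All \<subseteq> (B \<union> A1) \<union> S"
  proof
    fix j assume "j \<in> All"
    then obtain v where v: "real j < 2 ^ n * v" "2 ^ n * v < real j + 1" "strict_surv t n v" "j < 2 ^ n"
      by (auto simp: All_def open_cells_def)
    consider "v < u" | "u < v" | "v = u" by linarith
    then show "j \<in> (B \<union> A1) \<union> S"
      by cases (use v in \<open>auto simp: A1_def B_def S_def open_cells_def\<close>)
  qed
  then have "card All \<le> card (B \<union> A1) + card S"
    using card_mono[of "(B \<union> A1) \<union> S" All] card_Un_le[of "B \<union> A1" S] fin S by simp
  ultimately show ?thesis
    using cA S(2) unfolding cnt_def A_def[symmetric] A1_def[symmetric, unfolded u_def] All_def[symmetric] by simp
qed

text \<open>A strict survivor of positive time lies below \<open>t\<close>, so a cut above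
  \<open>t\<close> removes nothing. Level 0 imposes no such condition; there \<open>t > 0\<close>
  supplies a point below both cuts.\<close>

lemma cnt_min:
  assumes "t > 0"
  shows "cnt t n (min y t) = cnt t n y"
proof (cases n)
  case 0
  have "(\<exists>v>0. v < 1 \<and> v < y \<and> v < t) \<longleftrightarrow> (\<exists>v>0. v < 1 \<and> v < y)"
  proof
    assume "\<exists>v>0. v < 1 \<and> v < y"
    then obtain v where "v > 0" "v < 1" "v < y" by blast
    then show "\<exists>v>0. v < 1 \<and> v < y \<and> v < t" using assms by (intro exI[of _ "min v (t / 2)"]) auto
  qed blast
  then show ?thesis by (simp add: 0 cnt_def open_cells_0 strict_surv_def)
next
  case (Suc m)
  then show ?thesis by (auto simp: cnt_def strict_surv_Suc intro!: arg_cong[where f = card] arg_cong2[where f = open_cells])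
qed

text \<open>Both branches in one formula, with the orientation as a sign. Truncating at
  \<open>t\<close> keeps the new cut point at most \<open>t\<close>, so the step can be iterated
  along \<open>tau\<close>.\<close>

lemma cnt_step:
  assumes "y \<le> t" "1/2 < t"
  shows "\<bar>real (cnt t (Suc n) y) -
    ((1 - eps y) * real (strict_count t n) + eps y * real (cnt t n (min (tent y) t)))\<bar> \<le> 1"
proof (cases "y \<le> 1/2")
  case True
  then show ?thesis using assms cnt_left[OF True] cnt_min[of t] by (simp add: eps_def tent_def)
next
  case False
  then have "tent y = 2 - 2 * y" by (simp add: tent_def)
  then show ?thesis using False assms cnt_right[of y t n] cnt_min[of t] by (simp add: eps_def)
qed

lemma tau_le: "tau t k \<le> t"
  by (cases k) auto

lemma abs_theta: "\<bar>theta t k\<bar> = 1"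
  unfolding theta_def abs_prod by (rule prod.neutral) (simp add: eps_def)

definition knead :: "real \<Rightarrow> nat \<Rightarrow> real \<Rightarrow> real" where
  "knead t m x = (\<Sum>k<m. theta t k * x ^ k)"

text \<open>Multiplied by \<open>x ^ n\<close> and summed over \<open>n\<close>, the step relation
  links the generating functions of consecutive cut points; \<open>m\<close> substitutions express
  that of \<open>strict_count\<close> by the truncated kneading series. The right-hand side is free
  of \<open>t\<close>, and only finitely many signs enter.\<close>

lemma kneading_bound:
  assumes t: "1/2 < t" "t \<le> 1" and x: "0 < x" "x < 1"
    and summ: "summable (\<lambda>n. real (strict_count t n) * x ^ n)"
  shows "(\<Sum>n. real (strict_count t n) * x ^ n) * ((1 - x) * \<bar>knead t m x\<bar> - 2 * x ^ m) \<le> 1 / (1 - x)\<^sup>2"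
proof -
  define F where "F = (\<Sum>n. real (strict_count t n) * x ^ n)"
  define G where "G = (\<lambda>k. \<Sum>n. real (cnt t n (tau t k)) * x ^ n)"
  have sG: "summable (\<lambda>n. real (cnt t n y) * x ^ n)" for y
    by (rule summable_comparison_test'[OF summ, of 0])
      (use x cnt_le in \<open>auto simp: abs_mult intro!: mult_right_mono\<close>)
  have geo: "summable (\<lambda>n. x ^ n)" "(\<Sum>n. x ^ n) = 1 / (1 - x)"
    using x by (auto simp: suminf_geometric)
  have G: "0 \<le> G k" "G k \<le> F" for k
    unfolding G_def F_def using x cnt_le
    by (auto intro!: suminf_nonneg suminf_le sG summ mult_right_mono)
  have "cnt t n t = strict_count t n" for n
  proof (cases n)
    case 0
    have "\<exists>v>0. v < 1 \<and> v < t" using t by (intro exI[of _ "1/2"]) auto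
    moreover have "\<exists>v>0. v < (1 :: real)" by (intro exI[of _ "1/2"]) auto
    ultimately show ?thesis by (simp add: 0 cnt_def open_cells_0 strict_surv_def)
  next
    case (Suc m)
    then show ?thesis by (auto simp: cnt_def strict_surv_Suc intro!: arg_cong[where f = card] arg_cong2[where f = open_cells])
  qed
  then have G0: "G 0 = F" by (simp add: G_def F_def)
  have step: "\<bar>G k - (1 - eps (tau t k)) * x * F - eps (tau t k) * x * G (Suc k)\<bar> \<le> 1 / (1 - x)" for k
  proof -
    let ?e = "eps (tau t k)"
    define d where "d = (\<lambda>n. real (cnt t (Suc n) (tau t k)) -
      ((1 - ?e) * real (strict_count t n) + ?e * real (cnt t n (tau t (Suc k)))))"
    have d: "\<bar>d n\<bar> \<le> 1" for n
      unfolding d_def tau.simps by (rule cnt_step[OF tau_le t(1)])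
    have sd: "summable (\<lambda>n. d n * x ^ n)"
      by (rule summable_comparison_test'[OF geo(1), of 0]) (use x d in \<open>auto simp: abs_mult intro: mult_left_le_one_le\<close>)
    have sS: "summable (\<lambda>n. real (cnt t (Suc n) (tau t k)) * x ^ n)"
    proof -
      have "(\<lambda>n. real (cnt t (Suc n) (tau t k)) * x ^ n) =
        (\<lambda>n. d n * x ^ n + ((1 - ?e) * (real (strict_count t n) * x ^ n) + ?e * (real (cnt t n (tau t (Suc k))) * x ^ n)))"
        by (auto simp: d_def algebra_simps)
      then show ?thesis by (simp only: summable_add summable_mult sd summ sG)
    qed
    have "G k = real (cnt t 0 (tau t k)) + (\<Sum>n. real (cnt t (Suc n) (tau t k)) * x ^ Suc n)"
      unfolding G_def by (subst suminf_split_head[OF sG]) simp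
    also have "(\<Sum>n. real (cnt t (Suc n) (tau t k)) * x ^ Suc n) = x * (\<Sum>n. real (cnt t (Suc n) (tau t k)) * x ^ n)"
      by (subst suminf_mult[OF sS, symmetric]) (simp add: mult_ac)
    also have "(\<Sum>n. real (cnt t (Suc n) (tau t k)) * x ^ n) =
      (\<Sum>n. d n * x ^ n + ((1 - ?e) * (real (strict_count t n) * x ^ n) + ?e * (real (cnt t n (tau t (Suc k))) * x ^ n)))"
      by (intro arg_cong[where f = suminf]) (auto simp: d_def algebra_simps)
    also have "\<dots> = (\<Sum>n. d n * x ^ n) + ((1 - ?e) * F + ?e * G (Suc k))"
      unfolding F_def G_def
      by (simp only: suminf_add[symmetric] summable_add summable_mult sd summ sG suminf_mult)
    finally have eq: "G k - (1 - ?e) * x * F - ?e * x * G (Suc k) = real (cnt t 0 (tau t k)) + x * (\<Sum>n. d n * x ^ n)"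
      by (simp add: algebra_simps)
    have "cnt t 0 (tau t k) \<le> 1"
      by (simp add: cnt_def open_cells_0)
    moreover have "\<bar>\<Sum>n. d n * x ^ n\<bar> \<le> 1 / (1 - x)"
    proof -
      have b: "d n * x ^ n \<le> x ^ n" "- (d n * x ^ n) \<le> x ^ n" for n
        using mult_right_mono[of "d n" 1 "x ^ n"] mult_right_mono[of "- d n" 1 "x ^ n"] d[of n] x by auto
      have "(\<Sum>n. d n * x ^ n) \<le> (\<Sum>n. x ^ n)" by (intro suminf_le b sd geo)
      moreover have "(\<Sum>n. - (d n * x ^ n)) \<le> (\<Sum>n. x ^ n)" by (intro suminf_le b summable_minus sd geo)
      ultimately have "\<bar>\<Sum>n. d n * x ^ n\<bar> \<le> (\<Sum>n. x ^ n)" by (simp add: suminf_minus[OF sd])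
      then show ?thesis using geo by simp
    qed
    then have "x * \<bar>\<Sum>n. d n * x ^ n\<bar> \<le> x * (1 / (1 - x))" using x by (intro mult_left_mono) auto
    \<comment> \<open>Level 0 contributes at most 1 to the error, the later levels at most
      \<open>x / (1 - x)\<close>.\<close>
    moreover have "1 + x * (1 / (1 - x)) = 1 / (1 - x)" using x by (simp add: field_simps)
    moreover have "\<bar>real (cnt t 0 (tau t k)) + x * (\<Sum>n. d n * x ^ n)\<bar> \<le>
        real (cnt t 0 (tau t k)) + x * \<bar>\<Sum>n. d n * x ^ n\<bar>"
      using x by (simp add: abs_mult order_trans[OF abs_triangle_ineq])
    ultimately show ?thesis unfolding eq by linarith
  qed
  \<comment> \<open>The factor of \<open>F\<close> after \<open>m\<close> substitutions. It starts
    at 1 and loses \<open>theta t k * x ^ k * ((1 - eps (tau t k)) * x)\<close> at step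
    \<open>k\<close>; these losses telescope to the closed form.\<close>
  define P where "P = (\<lambda>m. (1 - x) * knead t m x + theta t m * x ^ m)"
  have PS: "P (Suc m) = P m - theta t m * x ^ m * ((1 - eps (tau t m)) * x)" for m
    by (simp add: P_def knead_def theta_def algebra_simps)
  have main: "\<bar>F * P m - theta t m * x ^ m * G m\<bar> \<le> (\<Sum>k<m. x ^ k / (1 - x))" for m
  proof (induction m)
    case 0
    then show ?case by (simp add: P_def knead_def theta_def G0)
  next
    case (Suc m)
    let ?D = "G m - (1 - eps (tau t m)) * x * F - eps (tau t m) * x * G (Suc m)"
    have "F * P (Suc m) - theta t (Suc m) * x ^ Suc m * G (Suc m) =
      (F * P m - theta t m * x ^ m * G m) + theta t m * x ^ m * ?D"
      unfolding PS by (simp add: theta_def algebra_simps)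
    moreover have "\<bar>theta t m * x ^ m * ?D\<bar> \<le> x ^ m * (1 / (1 - x))"
      using mult_left_mono[OF step[of m], of "x ^ m"] x by (simp only: abs_mult abs_theta) simp
    ultimately show ?case using Suc by simp
  qed
  have "(\<Sum>k<m. x ^ k / (1 - x)) = (\<Sum>k<m. x ^ k) / (1 - x)" by (simp add: sum_divide_distrib)
  also have "\<dots> \<le> (1 / (1 - x)) / (1 - x)"
    using x sum_le_suminf[OF geo(1), of "{..<m}"] geo(2) by (intro divide_right_mono) auto
  finally have "\<bar>F * P m - theta t m * x ^ m * G m\<bar> \<le> 1 / (1 - x)\<^sup>2"
    using main[of m] by (simp add: power2_eq_square)
  moreover have "\<bar>theta t m * x ^ m * G m\<bar> \<le> x ^ m * F"
    using G[of m] x by (simp only: abs_mult abs_theta) (auto intro!: mult_left_mono)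
  moreover have "F * ((1 - x) * \<bar>knead t m x\<bar> - x ^ m) \<le> \<bar>F * P m\<bar>"
  proof -
    have "(1 - x) * \<bar>knead t m x\<bar> = \<bar>P m - theta t m * x ^ m\<bar>" using x by (simp add: P_def abs_mult)
    also have "\<dots> \<le> \<bar>P m\<bar> + x ^ m"
      using abs_triangle_ineq4[of "P m" "theta t m * x ^ m"] x by (simp add: abs_mult abs_theta)
    finally show ?thesis using G[of 0] G0 by (auto simp: abs_mult intro!: mult_left_mono)
  qed
  \<comment> \<open>One \<open>x ^ m\<close> comes from replacing \<open>P m\<close> by the kneading
    sum, the other from the remainder, as \<open>G m \<le> F\<close>.\<close>
  ultimately have "F * ((1 - x) * \<bar>knead t m x\<bar> - x ^ m) - x ^ m * F \<le> 1 / (1 - x)\<^sup>2" by linarith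
  then show ?thesis unfolding F_def[symmetric] by (simp add: algebra_simps)
qed

section \<open>Left continuity\<close>

text \<open>Otherwise the series, holomorphic in the unit disc, vanishes on an interval and hence
  identically, against \<open>\<bar>c 0\<bar> = 1\<close>.\<close>

lemma power_series_nonzero_between:
  fixes c :: "nat \<Rightarrow> real"
  assumes c: "\<And>k. \<bar>c k\<bar> = 1" and pq: "0 < p" "p < q" "q < 1"
  shows "\<exists>x. p < x \<and> x < q \<and> (\<Sum>k. c k * x ^ k) \<noteq> 0"
proof (rule ccontr)
  assume neg: "\<not> ?thesis"
  have summ: "summable (\<lambda>k. complex_of_real (c k) * z ^ k)" if "norm z < 1" for z
    by (rule summable_comparison_test'[OF summable_geometric[of "norm z"], of 0])
      (use that c in \<open>auto simp: norm_mult norm_power\<close>)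
  define f where "f = (\<lambda>z. \<Sum>k. complex_of_real (c k) * z ^ k)"
  have hol: "f holomorphic_on ball 0 1"
    by (rule power_series_holomorphic[where a = "\<lambda>k. complex_of_real (c k)"])
      (use summ in \<open>auto simp: f_def summable_sums\<close>)
  define U where "U = complex_of_real ` {p<..<q}"
  have zero: "f z = 0" if "z \<in> U" for z
  proof -
    obtain x where x: "z = complex_of_real x" "p < x" "x < q" using \<open>z \<in> U\<close> by (auto simp: U_def)
    have "summable (\<lambda>k. c k * x ^ k)"
      by (rule summable_comparison_test'[OF summable_geometric[of x], of 0])
        (use x pq c in \<open>auto simp: abs_mult power_abs\<close>)
    then have "f z = complex_of_real (\<Sum>k. c k * x ^ k)"
      by (simp add: f_def x(1) suminf_of_real)
    then show ?thesis using neg x by auto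
  qed
  define \<xi> where "\<xi> = (p + q) / 2"
  have "\<xi> islimpt {p<..<q}" using pq by (intro interior_limit_point) (simp add: \<xi>_def)
  then have "complex_of_real \<xi> islimpt U"
    unfolding U_def islimpt_sequential
    by (elim exE conjE) (rule_tac x = "\<lambda>n. complex_of_real (f n)" in exI, auto intro: tendsto_of_real)
  moreover have "U \<subseteq> ball 0 1" using pq by (auto simp: U_def)
  moreover have "complex_of_real \<xi> \<in> ball 0 1"
    using pq unfolding mem_ball dist_0_norm norm_of_real by (simp add: \<xi>_def)
  ultimately have "f 0 = 0"
    using analytic_continuation[OF hol open_ball connected_ball, of U "complex_of_real \<xi>" 0] zero by auto
  moreover have "f 0 = complex_of_real (c 0)" unfolding f_def by (simp add: suminf_eq_zero_iff)
  ultimately show False using c[of 0] by simp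
qed

lemma isCont_tau: "isCont (\<lambda>s. tau s k) t"
proof (induction k)
  case (Suc k)
  have "isCont tent x" for x using isCont_tent_funpow[where i=1 and x=x] by simp
  then show ?case using isCont_o2[OF Suc, of tent] by (auto intro: continuous_min)
qed simp

lemma eventually_eps_tau:
  assumes "tau t k \<noteq> 1/2"
  shows "eventually (\<lambda>s. eps (tau s k) = eps (tau t k)) (at_left t)"
proof -
  have lim: "((\<lambda>s. tau s k) \<longlongrightarrow> tau t k) (at_left t)"
    using isCont_tau[where k=k and t=t] by (simp add: continuous_within filterlim_at_split isCont_def)
  show ?thesis
  proof (cases "tau t k < 1/2")
    case True
    from order_tendstoD(2)[OF lim this] show ?thesis
      by eventually_elim (use True in \<open>simp add: eps_def\<close>)
  next
    case False
    then have "1/2 < tau t k" using assms by simp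
    from order_tendstoD(1)[OF lim this] show ?thesis
      by eventually_elim (use False assms in \<open>simp add: eps_def\<close>)
  qed
qed

text \<open>Each of the finitely many cells has a witness whose finitely many strict inequalities
  survive a small decrease of \<open>t\<close>.\<close>

lemma eventually_strict_count_le: "eventually (\<lambda>s. strict_count t n \<le> strict_count s n) (at_left t)"
proof -
  have "eventually (\<lambda>s. j \<in> open_cells n (strict_surv s n)) (at_left t)"
    if "j \<in> open_cells n (strict_surv t n)" for j
  proof -
    obtain v where v: "j < 2 ^ n" "real j < 2 ^ n * v" "2 ^ n * v < real j + 1" "strict_surv t n v"
      using \<open>j \<in> _\<close> by (auto simp: open_cells_def)
    have "eventually (\<lambda>s. \<forall>i\<in>{..<n}. (tent ^^ i) v < s) (at_left t)"
      using v(4) by (intro eventually_ball_finite ballI order_tendstoD(1)[OF tendsto_ident_at])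
        (auto simp: strict_surv_def)
    then show ?thesis by eventually_elim (use v in \<open>auto simp: open_cells_def strict_surv_def\<close>)
  qed
  then have "eventually (\<lambda>s. \<forall>j\<in>open_cells n (strict_surv t n). j \<in> open_cells n (strict_surv s n)) (at_left t)"
    by (intro eventually_ball_finite) auto
  then show ?thesis by eventually_elim (auto intro: card_mono)
qed

lemma tau_eq_funpow:
  assumes "\<And>k. (tent ^^ k) t \<le> t"
  shows "tau t k = (tent ^^ k) t"
proof (induction k)
  case (Suc k)
  then show ?case using assms[of "Suc k"] by simp
qed simp

text \<open>At a fixed \<open>x\<close> between \<open>1 / \<gamma>\<close> and
  \<open>1 / \<beta>\<close> where the kneading series is nonzero, the generating functions at all
  \<open>s\<close> close enough to \<open>t\<close> from the left share a bound \<open>B\<close>. A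
  coefficient at \<open>t\<close> is at most one at such an \<open>s\<close>, hence at most
  \<open>B / x ^ n\<close>, which is a rate below \<open>\<gamma>\<close>.\<close>

lemma exp_bounded_left_limit:
  assumes t: "1/2 < t" "t \<le> 1" and orb: "\<And>k. (tent ^^ k) t \<le> t"
    and \<beta>: "1 \<le> \<beta>" "\<beta> < \<gamma>"
    and below: "\<And>s. 1/2 < s \<Longrightarrow> s < t \<Longrightarrow> exp_bounded (\<lambda>n. card (cells n (surv s n))) \<beta>"
  shows "exp_bounded (\<lambda>n. card (cells n (surv t n))) \<gamma>"
proof -
  have "tau t k \<noteq> 1/2" for k
  proof
    assume "tau t k = 1/2"
    \<comment> \<open>The next iterate of 1/2 is 1, which forces \<open>t = 1\<close>; but the orbit
      of 1 consists of 0 and 1.\<close>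
    then have half: "(tent ^^ k) t = 1/2" using tau_eq_funpow[OF orb] by simp
    then have "(tent ^^ Suc k) t = 1" by (simp add: tent_def)
    then have "t = 1" using orb[of "Suc k"] t by simp
    have "(tent ^^ i) 1 \<in> {0, 1}" for i by (induction i) (auto simp: tent_def)
    from this[of k] show False using half \<open>t = 1\<close> by simp
  qed
  note eps_ev = eventually_eps_tau[OF this]
  have p: "0 < 1 / \<gamma>" "1 / \<gamma> < 1 / \<beta>" "1 / \<beta> \<le> 1" using \<beta> by (auto simp: field_simps)
  \<comment> \<open>The midpoint keeps \<open>q < 1\<close> even if
    \<open>\<beta> = 1\<close>.\<close>
  define q where "q = (1 / \<gamma> + 1 / \<beta>) / 2"
  have q: "1 / \<gamma> < q" "q < 1 / \<beta>" "q < 1" using p by (auto simp: q_def)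
  obtain x where x: "1 / \<gamma> < x" "x < q" "(\<Sum>k. theta t k * x ^ k) \<noteq> 0"
    using power_series_nonzero_between[of "theta t", OF abs_theta p(1) q(1,3)] by blast
  have x01: "0 < x" "x < 1" using x p q by linarith+
  define K where "K = (\<Sum>k. theta t k * x ^ k)"
  define \<kappa> where "\<kappa> = (1 - x) * \<bar>K\<bar> / 2"
  have "summable (\<lambda>k. theta t k * x ^ k)"
    by (rule summable_comparison_test'[OF summable_geometric[of x], of 0])
      (use x01 in \<open>auto simp: abs_mult power_abs abs_theta\<close>)
  then have "(\<lambda>m. knead t m x) \<longlonglongrightarrow> K"
    unfolding knead_def K_def by (rule summable_LIMSEQ)
  then have "(\<lambda>m. (1 - x) * \<bar>knead t m x\<bar> - 2 * x ^ m) \<longlonglongrightarrow> (1 - x) * \<bar>K\<bar> - 2 * 0"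
    using x01 by (intro tendsto_intros LIMSEQ_realpow_zero) auto
  moreover have "\<kappa> > 0" "\<kappa> < (1 - x) * \<bar>K\<bar> - 2 * 0" using x(3) x01 by (auto simp: \<kappa>_def K_def)
  ultimately have "eventually (\<lambda>m. \<kappa> < (1 - x) * \<bar>knead t m x\<bar> - 2 * x ^ m) sequentially"
    by (blast dest: order_tendstoD(1))
  then obtain m where m: "\<kappa> < (1 - x) * \<bar>knead t m x\<bar> - 2 * x ^ m"
    by (auto simp: eventually_sequentially)
  define B where "B = 1 / (1 - x)\<^sup>2 / \<kappa>"
  \<comment> \<open>The parameter \<open>s\<close> chosen below depends on \<open>n\<close>, whereas
    \<open>m\<close> and \<open>B\<close> do not.\<close>
  have "real (strict_count t n) \<le> B * (1 / x) ^ n" for n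
  proof -
    have "eventually (\<lambda>s. \<forall>k\<in>{..<m}. eps (tau s k) = eps (tau t k)) (at_left t)"
      using eps_ev by (intro eventually_ball_finite) auto
    moreover have "eventually (\<lambda>s. 1/2 < s \<and> s < t) (at_left t)"
      using t(1) eventually_at_left[OF t(1)] by blast
    ultimately have "eventually (\<lambda>s. (\<forall>k\<in>{..<m}. eps (tau s k) = eps (tau t k)) \<and>
        (1/2 < s \<and> s < t) \<and> strict_count t n \<le> strict_count s n) (at_left t)"
      using eventually_strict_count_le[where t=t and n=n] by eventually_elim auto
    then obtain s where s: "\<And>k. k < m \<Longrightarrow> eps (tau s k) = eps (tau t k)" "1/2 < s" "s < t"
      "strict_count t n \<le> strict_count s n"
      by (auto dest!: eventually_happens)
    have "theta s k = theta t k" if "k < m" for k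
      using that s(1) unfolding theta_def by (intro prod.cong) auto
    then have kn: "knead s m x = knead t m x" unfolding knead_def by (intro sum.cong) auto
    obtain C where C: "C \<ge> 0" "\<And>n. real (card (cells n (surv s n))) \<le> C * \<beta> ^ n"
      using exp_bounded_const_nonneg[OF below[OF s(2,3)]] by blast
    \<comment> \<open>The rate below \<open>t\<close> enters through convergence at \<open>x\<close>
      alone, so \<open>C\<close> may depend on \<open>s\<close>.\<close>
    have "x < 1 / \<beta>" using x q by linarith
    then have "summable (\<lambda>n. C * (\<beta> * x) ^ n)"
      using x q \<beta> x01 by (intro summable_mult summable_geometric) (simp add: abs_mult field_simps)
    then have summ: "summable (\<lambda>n. real (strict_count s n) * x ^ n)"
    proof (rule summable_comparison_test'[of _ 0])
      fix n
      have "real (strict_count s n) \<le> real (card (cells n (surv s n)))"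
        by (intro of_nat_mono card_mono open_cells_subset_cells) auto
      also have "\<dots> \<le> C * \<beta> ^ n" by (rule C)
      finally show "norm (real (strict_count s n) * x ^ n) \<le> C * (\<beta> * x) ^ n"
        using x01 by (simp add: abs_mult power_mult_distrib mult_right_mono)
    qed
    let ?F = "\<Sum>n. real (strict_count s n) * x ^ n"
    have nn: "0 \<le> real (strict_count s n) * x ^ n" for n using x01 by simp
    have "?F * \<kappa> \<le> ?F * ((1 - x) * \<bar>knead s m x\<bar> - 2 * x ^ m)"
      using m kn suminf_nonneg[OF summ nn] by (intro mult_left_mono) auto
    also have "\<dots> \<le> 1 / (1 - x)\<^sup>2" using kneading_bound[OF s(2) _ x01 summ] s(3) t(2) by simp
    finally have F: "?F \<le> B" using \<open>\<kappa> > 0\<close> unfolding B_def by (simp only: pos_le_divide_eq)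
    have "real (strict_count t n) * x ^ n \<le> real (strict_count s n) * x ^ n" using s(4) x01 by (intro mult_right_mono) auto
    also have "\<dots> \<le> ?F" using sum_le_suminf[OF summ, of "{n}"] nn by simp
    finally have "real (strict_count t n) * x ^ n \<le> B" using F by simp
    then show ?thesis using x01 by (simp add: power_divide pos_le_divide_eq)
  qed
  then have "exp_bounded (strict_count t) (1 / x)" unfolding exp_bounded_def by blast
  then have "exp_bounded (\<lambda>n. card (cells n (surv t n))) (1 / x)"
    using x01 by (intro exp_bounded_open_cells) auto
  then show ?thesis using x(1) x01 \<beta> by (elim exp_bounded_mono) (auto simp: field_simps)
qed

section \<open>The doubling map and the tent map\<close>

definition tent_coord :: "real \<Rightarrow> real" where
  "tent_coord x = 2 * min x (1 - x)"

lemma doubling_eq: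
  assumes "0 \<le> x" "x \<le> 1"
  shows "doubling x = (if x < 1/2 then 2 * x else if x < 1 then 2 * x - 1 else 0)"
proof -
  have "frac (2 * x) = 2 * x - 1" if "1/2 \<le> x" "x < 1"
    using that by (simp add: frac_unique_iff)
  then show ?thesis using assms by (auto simp: doubling_def frac_eq)
qed

lemma doubling_bounds: "0 \<le> doubling x \<and> doubling x < 1"
  by (simp add: doubling_def frac_lt_1)

lemma doubling_funpow_bounds:
  assumes "0 \<le> x" "x \<le> 1"
  shows "0 \<le> (doubling ^^ n) x \<and> (doubling ^^ n) x \<le> 1"
  using assms doubling_bounds by (cases n) (auto simp: less_imp_le)

lemma doubling_funpow_less:
  assumes "0 \<le> x" "x < 1"
  shows "0 \<le> (doubling ^^ n) x \<and> (doubling ^^ n) x < 1"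
  using assms doubling_bounds by (cases n) auto

lemma tent_coord_doubling:
  assumes "0 \<le> x" "x \<le> 1"
  shows "tent_coord (doubling x) = tent (tent_coord x)"
  using assms unfolding doubling_eq[OF assms] tent_coord_def tent_def by (auto simp: min_def abs_if)

lemma tent_coord_doubling_funpow:
  assumes "0 \<le> x" "x \<le> 1"
  shows "tent_coord ((doubling ^^ n) x) = (tent ^^ n) (tent_coord x)"
proof (induction n)
  case (Suc n)
  then show ?case using tent_coord_doubling doubling_funpow_bounds[OF assms, of n] by simp
qed simp

lemma tent_coord_bounds: "0 \<le> x \<Longrightarrow> x \<le> 1 \<Longrightarrow> 0 \<le> tent_coord x \<and> tent_coord x \<le> 1"
  by (auto simp: tent_coord_def min_def)

lemma tent_coord_frac: "0 \<le> x \<Longrightarrow> x \<le> 1 \<Longrightarrow> tent_coord (frac x) = tent_coord x"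
  by (cases "x = 1") (auto simp: tent_coord_def frac_eq)

lemma mem_attractor_iff:
  "x \<in> attractor a \<longleftrightarrow> 0 \<le> x \<and> x \<le> 1 \<and> (\<forall>n. (tent ^^ n) (tent_coord x) \<le> 2 * a) \<and> 1 - 2 * a \<le> x \<and> x \<le> 2 * a"
proof -
  have "y \<notin> hole a \<longleftrightarrow> tent_coord y \<le> 2 * a" for y by (auto simp: hole_def tent_coord_def min_def)
  then show ?thesis by (auto simp: attractor_def tent_coord_doubling_funpow)
qed

lemma mspace_attractor_spaceD:
  assumes "x \<in> mspace (attractor_space a)"
  shows "0 \<le> x" "x < 1" "\<And>n. (tent ^^ n) (tent_coord x) \<le> 2 * a"
  using assms by (auto simp: mem_attractor_iff tent_coord_frac frac_lt_1)

section \<open>The upper bound for the entropy\<close>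

lemma cell_exists:
  assumes "0 \<le> v" "v \<le> 1"
  shows "\<exists>j<2 ^ n. real j \<le> 2 ^ n * v \<and> 2 ^ n * v \<le> real j + 1"
proof (cases "v = 1")
  case True
  then show ?thesis by (intro exI[of _ "2 ^ n - 1"]) (simp add: of_nat_diff)
next
  case False
  have "nat \<lfloor>2 ^ n * v\<rfloor> < 2 ^ n" using assms False by (simp add: nat_less_iff floor_less_iff)
  moreover have "0 \<le> 2 ^ n * v" using assms by simp
  ultimately show ?thesis by (intro exI[of _ "nat \<lfloor>2 ^ n * v\<rfloor>"]) auto
qed

lemma circle_dist_doubling_le:
  assumes "0 \<le> x" "x < 1" "0 \<le> y" "y < 1"
  shows "circle_dist (doubling x) (doubling y) \<le> 2 * circle_dist x y"
  using assms doubling_bounds[of x] doubling_bounds[of y]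
  by (simp add: circle_dist_eq doubling_eq min_def abs_if)

lemma circle_dist_doubling_eq:
  assumes "0 \<le> x" "x < 1" "0 \<le> y" "y < 1" "circle_dist x y \<le> 1/4"
  shows "circle_dist (doubling x) (doubling y) = 2 * circle_dist x y"
  using assms doubling_bounds[of x] doubling_bounds[of y]
  by (simp add: circle_dist_eq doubling_eq min_def abs_if split: if_splits)

lemma circle_dist_doubling_funpow_le:
  assumes "0 \<le> x" "x < 1" "0 \<le> y" "y < 1"
  shows "circle_dist ((doubling ^^ i) x) ((doubling ^^ i) y) \<le> 2 ^ i * \<bar>x - y\<bar>"
proof (induction i)
  case 0
  then show ?case using assms by (simp add: circle_dist_eq)
next
  case (Suc i)
  then show ?case
    using circle_dist_doubling_le[of "(doubling ^^ i) x" "(doubling ^^ i) y"]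
      doubling_funpow_less assms by fastforce
qed

text \<open>Two points in the same half of the circle and in the same cell of level
  \<open>n + q\<close> stay within \<open>1 / 2 ^ q\<close> for \<open>n\<close> steps. The factor 2
  counts the halves, which the folding identifies.\<close>

lemma card_separated_le:
  assumes E: "E \<in> separated_sets (attractor_space a) doubling n \<epsilon>" and q: "1 / 2 ^ q \<le> \<epsilon>"
  shows "card E \<le> 2 * card (cells (n + q) (surv (2 * a) (n + q)))"
proof -
  let ?N = "n + q"
  have E': "0 \<le> x" "x < 1" "\<And>i. (tent ^^ i) (tent_coord x) \<le> 2 * a" if "x \<in> E" for x
    using mspace_attractor_spaceD that E by (auto simp: separated_sets_def simp del: mspace_attractor_space)
  have "\<exists>j<2 ^ ?N. real j \<le> 2 ^ ?N * tent_coord x \<and> 2 ^ ?N * tent_coord x \<le> real j + 1" if "x \<in> E" for x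
    using E'[OF that] tent_coord_bounds by (intro cell_exists) auto
  then obtain f where f: "\<And>x. x \<in> E \<Longrightarrow> f x < 2 ^ ?N \<and> real (f x) \<le> 2 ^ ?N * tent_coord x \<and> 2 ^ ?N * tent_coord x \<le> real (f x) + 1"
    by metis
  define g where "g = (\<lambda>x. (x < 1/2, f x))"
  have "inj_on g E"
  proof (rule inj_onI, rule ccontr)
    fix x y assume xy: "x \<in> E" "y \<in> E" "g x = g y" "x \<noteq> y"
    have "\<exists>i<n. \<epsilon> < circle_dist ((doubling ^^ i) x) ((doubling ^^ i) y)"
      using E xy(1,2,4) by (simp add: separated_sets_def)
    then obtain i where i: "i < n" "\<epsilon> < circle_dist ((doubling ^^ i) x) ((doubling ^^ i) y)" by blast
    have "x < 1/2 \<longleftrightarrow> y < 1/2" "f x = f y" using xy(3) by (auto simp: g_def)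
    then have "\<bar>2 ^ ?N * tent_coord x - 2 ^ ?N * tent_coord y\<bar> \<le> 1" using f[OF xy(1)] f[OF xy(2)] by auto
    then have "2 ^ ?N * \<bar>tent_coord x - tent_coord y\<bar> \<le> 1" by (simp add: abs_mult flip: right_diff_distrib)
    moreover have "\<bar>tent_coord x - tent_coord y\<bar> = 2 * \<bar>x - y\<bar>"
      using \<open>x < 1/2 \<longleftrightarrow> y < 1/2\<close> by (auto simp: tent_coord_def min_def abs_if)
    ultimately have "2 ^ n * 2 ^ q * \<bar>x - y\<bar> \<le> 1" by (simp add: power_add)
    then have "2 ^ n * \<bar>x - y\<bar> \<le> 1 / 2 ^ q" by (simp add: field_simps)
    moreover have "2 ^ i * \<bar>x - y\<bar> \<le> 2 ^ n * \<bar>x - y\<bar>" using i(1) by (intro mult_right_mono) auto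
    ultimately show False
      using circle_dist_doubling_funpow_le[of x y i] E' xy(1,2) i(2) q by fastforce
  qed
  moreover have "g ` E \<subseteq> UNIV \<times> cells ?N (surv (2 * a) ?N)"
    using f E' unfolding g_def cells_def surv_def by blast
  ultimately have "card E \<le> card ((UNIV :: bool set) \<times> cells ?N (surv (2 * a) ?N))"
    by (intro card_inj_on_le) auto
  then show ?thesis by (simp add: card_cartesian_product)
qed

lemma topological_entropy_le:
  assumes V: "exp_bounded (\<lambda>n. card (cells n (surv (2 * a) n))) \<beta>" and "1 \<le> \<beta>"
  shows "topological_entropy (attractor_space a) doubling \<le> ereal (log 2 \<beta>)"
  unfolding topological_entropy_def
proof (rule SUP_least)
  fix \<epsilon> :: real assume "\<epsilon> \<in> {0<..}"
  then obtain q where "(1/2) ^ q < \<epsilon>" using real_arch_pow_inv[of \<epsilon> "1/2"] by auto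
  then have q: "1 / 2 ^ q \<le> \<epsilon>" by (simp add: power_one_over)
  obtain C where C: "C \<ge> 0" "\<And>n. real (card (cells n (surv (2 * a) n))) \<le> C * \<beta> ^ n"
    using exp_bounded_const_nonneg[OF V] by blast
  \<comment> \<open>The summand 1 makes \<open>log 2 M\<close> nonnegative: for \<open>n = 0\<close>
    or empty \<open>E\<close> the left side of the bound is 0, by the conventions for division by 0
    and \<open>log 2 0\<close>.\<close>
  define M where "M = 2 * C * \<beta> ^ q + 1"
  have M: "M \<ge> 1" using C(1) assms(2) by (simp add: M_def)
  have bound: "log 2 (real (card E)) / real n \<le> log 2 M / real n + log 2 \<beta>"
    if E: "E \<in> separated_sets (attractor_space a) doubling n \<epsilon>" for E n
  proof (cases "n = 0 \<or> E = {}")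
    case True
    then show ?thesis using M assms(2) by (auto simp: log_def)
  next
    case False
    have "finite E" using E by (simp add: separated_sets_def)
    then have "card E > 0" using False by (simp add: card_gt_0_iff)
    have "real (card E) \<le> real (2 * card (cells (n + q) (surv (2 * a) (n + q))))"
      using card_separated_le[OF E q] by (intro of_nat_mono)
    also have "\<dots> \<le> 2 * (C * \<beta> ^ (n + q))" using C(2)[of "n + q"] by simp
    also have "\<dots> \<le> M * \<beta> ^ n" using assms(2) by (simp add: M_def power_add algebra_simps)
    finally have "log 2 (real (card E)) \<le> log 2 (M * \<beta> ^ n)" using \<open>card E > 0\<close> by simp
    also have "\<dots> = log 2 M + real n * log 2 \<beta>" using M assms(2) by (simp add: log_mult log_nat_power)
    finally show ?thesis using False by (simp add: field_simps)
  qed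
  have "limsup (\<lambda>n. SUP E\<in>separated_sets (attractor_space a) doubling n \<epsilon>. ereal (log 2 (real (card E)) / real n))
      \<le> limsup (\<lambda>n. ereal (log 2 M / real n + log 2 \<beta>))"
    using bound by (intro Limsup_mono always_eventually allI SUP_least) auto
  also have "(\<lambda>n. log 2 M / real n + log 2 \<beta>) \<longlonglongrightarrow> 0 + log 2 \<beta>"
    by (intro tendsto_intros lim_const_over_n)
  then have "limsup (\<lambda>n. ereal (log 2 M / real n + log 2 \<beta>)) = ereal (log 2 \<beta>)"
    by (intro lim_imp_Limsup) auto
  finally show "limsup (\<lambda>n. SUP E\<in>separated_sets (attractor_space a) doubling n \<epsilon>. ereal (log 2 (real (card E)) / real n))
      \<le> ereal (log 2 \<beta>)" .
qed

section \<open>The lower bound for the entropy\<close>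

abbreviation orbit_le :: "real \<Rightarrow> real \<Rightarrow> bool" where
  "orbit_le t v \<equiv> \<forall>i. (tent ^^ i) v \<le> t"

abbreviation core_cells :: "real \<Rightarrow> nat \<Rightarrow> nat set" where
  "core_cells t n \<equiv> cells n (\<lambda>v. 2 - 2 * t \<le> v \<and> orbit_le t v)"

lemma orbit_le_tent: "orbit_le t v \<Longrightarrow> orbit_le t (tent v)"
  by (metis comp_apply funpow_Suc_right)

text \<open>One point per cell is pulled back to \<open>v / 2\<close> on the left branch of the
  folding; \<open>2 - 2 * t \<le> v\<close> puts it to the right of \<open>1 - 2 * a\<close>, as the
  attractor demands. Points of neighbouring cells may coincide, so only indices of one parity are
  kept, at the cost of a factor 2.\<close>

lemma separated_set_from_core:
  assumes a: "a \<in> {1/3..1/2}" and "n > 0"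
  shows "\<exists>E\<in>separated_sets (attractor_space a) doubling n (1/8). card (core_cells (2 * a) n) \<le> 2 * card E"
proof -
  let ?J = "core_cells (2 * a) n"
  have main: "\<exists>E\<in>separated_sets (attractor_space a) doubling n (1/8). card E = card J"
    if J: "J \<subseteq> ?J" and par: "\<And>i j. i \<in> J \<Longrightarrow> j \<in> J \<Longrightarrow> i < j \<Longrightarrow> i + 2 \<le> j" for J
  proof -
    have "\<exists>v. real j \<le> 2 ^ n * v \<and> 2 ^ n * v \<le> real j + 1 \<and> 2 - 2 * (2 * a) \<le> v \<and> orbit_le (2 * a) v"
      if "j \<in> J" for j using that J by (auto simp: cells_def)
    then obtain v where v: "\<And>j. j \<in> J \<Longrightarrow> real j \<le> 2 ^ n * v j \<and> 2 ^ n * v j \<le> real j + 1 \<and>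
        2 - 2 * (2 * a) \<le> v j \<and> orbit_le (2 * a) (v j)" by metis
    define x where "x = (\<lambda>j. v j / 2)"
    have v01: "0 \<le> v j" "v j \<le> 1" if "j \<in> J" for j
      using v[OF that] a by (auto dest!: spec[of _ 0])
    have dist: "1 / 2 ^ Suc n \<le> circle_dist (x i) (x j)" if ij: "i \<in> J" "j \<in> J" "i < j" for i j
    proof -
      have "real (i + 2) \<le> real j" using par[OF ij] by (intro of_nat_mono)
      then have "1 \<le> 2 ^ n * (v j - v i)"
        using v[OF ij(1)] v[OF ij(2)] by (simp add: right_diff_distrib)
      then have "1 / 2 ^ Suc n \<le> x j - x i" by (simp add: x_def field_simps)
      moreover have "circle_dist (x i) (x j) = \<bar>x i - x j\<bar>"
        using v01[OF ij(1)] v01[OF ij(2)] by (subst circle_dist_eq) (auto simp: x_def min_def abs_if)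
      ultimately show ?thesis by simp
    qed
    \<comment> \<open>Without separation the distance doubles at every step and grows from at least
      \<open>1 / 2 ^ Suc n\<close> to at least 1/4 at time \<open>n - 1\<close>. Any scale below 1/4
      would do.\<close>
    have sep: "\<exists>k<n. 1/8 < circle_dist ((doubling ^^ k) (x i)) ((doubling ^^ k) (x j))"
      if ij: "i \<in> J" "j \<in> J" "i < j" for i j
    proof (rule ccontr)
      assume "\<not> ?thesis"
      then have small: "circle_dist ((doubling ^^ k) (x i)) ((doubling ^^ k) (x j)) \<le> 1/8" if "k < n" for k
        using that by force
      have x: "0 \<le> x l" "x l < 1" if "l \<in> J" for l using v01[OF that] by (auto simp: x_def)
      have "circle_dist ((doubling ^^ k) (x i)) ((doubling ^^ k) (x j)) = 2 ^ k * circle_dist (x i) (x j)"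
        if "k < n" for k using that
      proof (induction k)
        case (Suc k)
        then show ?case
          using circle_dist_doubling_eq[of "(doubling ^^ k) (x i)" "(doubling ^^ k) (x j)"]
            small[of k] doubling_funpow_less x ij(1,2) by simp
      qed simp
      from this[of "n - 1"] small[of "n - 1"] have "2 ^ (n - 1) * circle_dist (x i) (x j) \<le> 1/8"
        using \<open>n > 0\<close> by simp
      moreover have "2 ^ (n - 1) * (1 / 2 ^ Suc n) \<le> 2 ^ (n - 1) * circle_dist (x i) (x j)"
        using dist[OF ij] by (intro mult_left_mono) auto
      moreover have "2 ^ (n - 1) * (1 / 2 ^ Suc n) = (1/4 :: real)"
        using \<open>n > 0\<close> by (cases n) auto
      ultimately show False by simp
    qed
    have "x i \<noteq> x j" if "i \<in> J" "j \<in> J" "i < j" for i j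
    proof
      assume "x i = x j"
      then have "circle_dist (x i) (x j) = 0" by (simp add: circle_dist_def)
      moreover have "(0 :: real) < 1 / 2 ^ Suc n" by simp
      ultimately show False using dist[OF that] by linarith
    qed
    then have inj: "inj_on x J" by (metis inj_onI linorder_neqE_nat)
    have "x j \<in> frac ` attractor a" if "j \<in> J" for j
    proof -
      have "tent_coord (x j) = v j" using v01[OF that] by (simp add: tent_coord_def x_def min_def)
      then have "x j \<in> attractor a"
        using v[OF that] v01[OF that] a by (auto simp: mem_attractor_iff x_def)
      moreover have "frac (x j) = x j" using v01[OF that] by (simp add: x_def frac_eq)
      ultimately show ?thesis by (metis image_eqI)
    qed
    moreover have "\<exists>k<n. 1/8 < circle_dist ((doubling ^^ k) (x i)) ((doubling ^^ k) (x j))"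
      if "i \<in> J" "j \<in> J" "x i \<noteq> x j" for i j
      using sep[of i j] sep[of j i] that by (metis circle_dist_def linorder_neqE_nat min.commute)
    moreover have "finite J" using J finite_cells by (rule finite_subset)
    ultimately have "x ` J \<in> separated_sets (attractor_space a) doubling n (1/8)"
      unfolding separated_sets_def by auto
    then show ?thesis using card_image[OF inj] by blast
  qed
  define J where "J = (\<lambda>b. {j \<in> ?J. even j = b})"
  have ex: "\<exists>E\<in>separated_sets (attractor_space a) doubling n (1/8). card E = card (J b)" for b
  proof (rule main)
    fix i j assume "i \<in> J b" "j \<in> J b" "i < j"
    then have "even i = even j" by (auto simp: J_def)
    then show "i + 2 \<le> j" using \<open>i < j\<close> by presburger
  qed (auto simp: J_def)
  have "card ?J \<le> card (J True) + card (J False)"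
  proof -
    have "?J = J True \<union> J False" by (auto simp: J_def)
    then show ?thesis by (metis card_Un_le)
  qed
  then have "card ?J \<le> 2 * card (J True) \<or> card ?J \<le> 2 * card (J False)" by linarith
  then obtain b where b: "card ?J \<le> 2 * card (J b)" by blast
  obtain E where E: "E \<in> separated_sets (attractor_space a) doubling n (1/8)" "card E = card (J b)"
    using ex[of b] by blast
  show ?thesis by (rule bexI[OF _ E(1)]) (use b E(2) in simp)
qed

text \<open>The empty set is separated and \<open>log 2 0 = 0\<close>.\<close>

lemma topological_entropy_nonneg: "0 \<le> topological_entropy (attractor_space a) doubling"
proof -
  have "0 \<le> limsup (\<lambda>n. SUP E\<in>separated_sets (attractor_space a) doubling n 1. ereal (log 2 (real (card E)) / real n))"
  proof (rule le_Limsup)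
    have "{} \<in> separated_sets (attractor_space a) doubling n 1" for n by (simp add: separated_sets_def)
    then show "\<forall>\<^sub>F n in sequentially. 0 \<le> (SUP E\<in>separated_sets (attractor_space a) doubling n 1. ereal (log 2 (real (card E)) / real n))"
      by (intro always_eventually allI SUP_upper2[of "{}"]) (auto simp: log_def)
  qed simp
  also have "\<dots> \<le> topological_entropy (attractor_space a) doubling"
    unfolding topological_entropy_def by (intro SUP_upper) auto
  finally show ?thesis .
qed

lemma exp_bounded_core:
  assumes a: "a \<in> {1/3..1/2}" and \<beta>: "1 < \<beta>"
    and less: "topological_entropy (attractor_space a) doubling < ereal (log 2 \<beta>)"
  shows "exp_bounded (\<lambda>n. card (core_cells (2 * a) n)) \<beta>"
proof -
  have "limsup (\<lambda>n. SUP E\<in>separated_sets (attractor_space a) doubling n (1/8). ereal (log 2 (real (card E)) / real n))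
      \<le> topological_entropy (attractor_space a) doubling"
    unfolding topological_entropy_def by (intro SUP_upper) auto
  also note less
  finally have "\<forall>\<^sub>F n in sequentially. (SUP E\<in>separated_sets (attractor_space a) doubling n (1/8).
      ereal (log 2 (real (card E)) / real n)) < ereal (log 2 \<beta>)" by (rule Limsup_lessD)
  then obtain N where N: "\<And>n. N \<le> n \<Longrightarrow> (SUP E\<in>separated_sets (attractor_space a) doubling n (1/8).
      ereal (log 2 (real (card E)) / real n)) < ereal (log 2 \<beta>)"
    by (auto simp: eventually_sequentially)
  \<comment> \<open>\<open>2 ^ Suc N\<close> covers the levels up to \<open>N\<close>, where the
    entropy says nothing; the 2 is the loss from choosing a parity.\<close>
  have "real (card (core_cells (2 * a) n)) \<le> (2 ^ Suc N + 2) * \<beta> ^ n" for n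
  proof (cases "n \<le> N")
    case True
    have "real (card (core_cells (2 * a) n)) \<le> real (2 ^ n)" using card_cells_le by (intro of_nat_mono)
    also have "\<dots> \<le> 2 ^ Suc N" using True by (simp add: power_increasing[of n "Suc N", simplified])
    also have "\<dots> \<le> (2 ^ Suc N + 2) * 1" by simp
    also have "\<dots> \<le> (2 ^ Suc N + 2) * \<beta> ^ n" using \<beta> by (intro mult_left_mono one_le_power) auto
    finally show ?thesis .
  next
    case False
    then have n: "n > 0" "N \<le> n" by auto
    obtain E where E: "E \<in> separated_sets (attractor_space a) doubling n (1/8)"
      "card (core_cells (2 * a) n) \<le> 2 * card E" using separated_set_from_core[OF a n(1)] by blast
    have "real (card E) \<le> \<beta> ^ n"
    proof (cases "card E = 0")
      case False
      have "ereal (log 2 (real (card E)) / real n) < ereal (log 2 \<beta>)"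
        using N[OF n(2)] SUP_upper[OF E(1), of "\<lambda>E. ereal (log 2 (real (card E)) / real n)"] by (rule le_less_trans[rotated])
      then have "log 2 (real (card E)) < real n * log 2 \<beta>" using n by (simp add: field_simps)
      also have "\<dots> = log 2 (\<beta> ^ n)" using \<beta> by (simp add: log_nat_power)
      finally show ?thesis using False \<beta> by simp
    qed (use \<beta> in simp)
    have "real (card (core_cells (2 * a) n)) \<le> real (2 * card E)" using E(2) by (intro of_nat_mono)
    also have "\<dots> \<le> 2 * \<beta> ^ n" using \<open>real (card E) \<le> \<beta> ^ n\<close> by simp
    also have "\<dots> \<le> (2 ^ Suc N + 2) * \<beta> ^ n" using \<beta> by (intro mult_right_mono) auto
    finally show ?thesis .
  qed
  then show ?thesis unfolding exp_bounded_def by blast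
qed

text \<open>The core \<open>v \<ge> 2 - 2 * t\<close> is the image under the tent map of the survivors on its right branch.\<close>

lemma card_orbit_cells_Suc:
  "card (cells (Suc n) (orbit_le t)) \<le> card (cells n (orbit_le t)) + card (core_cells t n)"
proof -
  define A where "A = cells (Suc n) (orbit_le t)"
  define g :: "nat \<Rightarrow> nat" where "g = (\<lambda>j. 2 ^ Suc n - 1 - j)"
  have L: "A \<inter> {..<2 ^ n} \<subseteq> cells n (orbit_le t)"
  proof
    fix j assume "j \<in> A \<inter> {..<2 ^ n}"
    then obtain v where v: "real j \<le> 2 ^ Suc n * v" "2 ^ Suc n * v \<le> real j + 1" "orbit_le t v" "j < 2 ^ n"
      unfolding A_def cells_def by blast
    have "j + 1 \<le> 2 ^ n" using v(4) by simp
    then have "real (j + 1) \<le> real (2 ^ n)" by (rule of_nat_mono)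
    moreover have eq: "2 ^ n * (2 * v) = 2 ^ Suc n * v" by simp
    ultimately have "2 ^ n * (2 * v) \<le> 2 ^ n * 1"
      using v(2) unfolding of_nat_add of_nat_power of_nat_numeral of_nat_1 by linarith
    then have "tent v = 2 * v" by (simp add: tent_def)
    then have "orbit_le t (2 * v)" using orbit_le_tent[OF v(3)] by simp
    then show "j \<in> cells n (orbit_le t)"
      using v eq unfolding cells_def by (intro CollectI conjI exI[of _ "2 * v"]) simp_all
  qed
  have R: "g ` (A \<inter> {2 ^ n..}) \<subseteq> core_cells t n"
  proof (rule image_subsetI)
    fix j assume "j \<in> A \<inter> {2 ^ n..}"
    then obtain v where v: "real j \<le> 2 ^ Suc n * v" "2 ^ Suc n * v \<le> real j + 1" "orbit_le t v"
      "2 ^ n \<le> j" "j < 2 ^ Suc n" unfolding A_def cells_def by blast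
    have "real (2 ^ n) \<le> real j" using v(4) by (intro of_nat_mono)
    moreover have "2 ^ n * (2 * v) = 2 ^ Suc n * v" by simp
    ultimately have "2 ^ n * 1 \<le> 2 ^ n * (2 * v)"
      using v(1) unfolding of_nat_power of_nat_numeral by linarith
    then have "tent v = 2 - 2 * v" by (simp add: tent_def)
    then have "orbit_le t (2 - 2 * v)" using orbit_le_tent[OF v(3)] by simp
    moreover have "2 - 2 * t \<le> 2 - 2 * v" using v(3)[rule_format, of 0] by simp
    moreover have "g j < 2 ^ n" using v(4) zero_less_power[of "2::nat" n] unfolding g_def power_Suc by linarith
    moreover have "real (g j) = 2 ^ Suc n - 1 - real j" using v(5) unfolding g_def by (simp add: of_nat_diff)
    moreover have "2 ^ n * (2 - 2 * v) = 2 ^ Suc n - 2 ^ Suc n * v" by (simp add: algebra_simps)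
    ultimately show "g j \<in> core_cells t n"
      using v(1,2) unfolding cells_def by (intro CollectI conjI exI[of _ "2 - 2 * v"]) (assumption | linarith)+
  qed
  have "inj_on g (A \<inter> {2 ^ n..})"
    unfolding g_def A_def cells_def by (intro inj_onI) auto
  then have "card (A \<inter> {2 ^ n..}) \<le> card (core_cells t n)" using R by (intro card_inj_on_le) auto
  moreover have "card (A \<inter> {..<2 ^ n}) \<le> card (cells n (orbit_le t))" using L by (intro card_mono) auto
  moreover have "A = (A \<inter> {..<2 ^ n}) \<union> (A \<inter> {2 ^ n..})" by auto
  then have "card A \<le> card (A \<inter> {..<2 ^ n}) + card (A \<inter> {2 ^ n..})" by (metis card_Un_le)
  ultimately show ?thesis unfolding A_def by linarith
qed

text \<open>Iterating \<open>card_orbit_cells_Suc\<close> gives 1 plus a sum of core counts; the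
  added 1 in \<open>g\<close> pays for the initial 1.\<close>

lemma exp_bounded_orbit_cells:
  assumes core: "exp_bounded (\<lambda>n. card (core_cells t n)) \<beta>" and "1 < \<beta>"
  shows "exp_bounded (\<lambda>n. card (cells n (orbit_le t))) \<beta>"
proof (rule exp_bounded_sum[where g = "\<lambda>n. card (core_cells t n) + 1" and c = 1 and d = 1])
  obtain C where C: "\<And>n. real (card (core_cells t n)) \<le> C * \<beta> ^ n" using core unfolding exp_bounded_def by blast
  have "real (card (core_cells t n) + 1) \<le> (C + 1) * \<beta> ^ n" for n
    using C[of n] one_le_power[OF less_imp_le[OF assms(2)], of n] by (simp add: distrib_right)
  then show "exp_bounded (\<lambda>n. card (core_cells t n) + 1) \<beta>" unfolding exp_bounded_def by blast
  have W: "card (cells n (orbit_le t)) \<le> 1 + (\<Sum>k<n. card (core_cells t k))" for n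
  proof (induction n)
    case 0
    then show ?case using card_cells_le[of 0 "orbit_le t"] by simp
  next
    case (Suc n)
    then show ?case using card_orbit_cells_Suc[of n t] by simp
  qed
  have le: "(\<Sum>k<n. card (core_cells t k)) \<le> (\<Sum>k<n. card (core_cells t k) + 1)" for n
    by (intro sum_mono) simp
  show "card (cells n (orbit_le t)) \<le> 1 * (card (core_cells t n) + 1) + (\<Sum>k<n. 1 * (card (core_cells t k) + 1))" for n
    using W[of n] le[of n] unfolding mult_1 by linarith
qed (rule assms)

section \<open>The growth rate\<close>

abbreviation bounded_growth :: "real \<Rightarrow> real \<Rightarrow> bool" where
  "bounded_growth t \<beta> \<equiv> exp_bounded (\<lambda>n. card (cells n (surv t n))) \<beta>"

text \<open>An infimum of admissible rates avoids the question whether a limit exists;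
  \<open>1 < \<beta>\<close> keeps it at least 1 for every real \<open>t\<close>, so its logarithm
  is never negative.\<close>

definition growth :: "real \<Rightarrow> real" where
  "growth t = Inf {\<beta>. 1 < \<beta> \<and> bounded_growth t \<beta>}"

lemma bounded_growth_2: "bounded_growth t 2"
proof -
  have "real (card (cells n (surv t n))) \<le> 1 * 2 ^ n" for n
    using of_nat_mono[OF card_cells_le[of n "surv t n"], where ?'a = real] by simp
  then show ?thesis unfolding exp_bounded_def by blast
qed

lemma bdd_below_growth: "bdd_below {\<beta>. 1 < \<beta> \<and> bounded_growth t \<beta>}"
  by (intro bdd_belowI[of _ 1]) auto

lemma growth_le: "1 < \<beta> \<Longrightarrow> bounded_growth t \<beta> \<Longrightarrow> growth t \<le> \<beta>"
  unfolding growth_def by (intro cInf_lower bdd_below_growth) auto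

lemma growth_ge_1: "1 \<le> growth t"
  unfolding growth_def using bounded_growth_2 by (intro cInf_greatest) (auto intro!: exI[of _ 2])

lemma bounded_growth_if_less:
  assumes "growth t < \<beta>"
  shows "bounded_growth t \<beta>"
proof -
  have "{\<beta>. 1 < \<beta> \<and> bounded_growth t \<beta>} \<noteq> {}" using bounded_growth_2 by (auto intro!: exI[of _ 2])
  from cInf_lessD[OF this assms[unfolded growth_def]]
  obtain \<gamma> where "1 < \<gamma>" "bounded_growth t \<gamma>" "\<gamma> < \<beta>" by blast
  then show ?thesis by (intro exp_bounded_mono[of _ \<gamma> \<beta>]) auto
qed

lemma bounded_growth_antimono: "bounded_growth s \<beta> \<Longrightarrow> t \<le> s \<Longrightarrow> bounded_growth t \<beta>"
  by (erule exp_bounded_le) (auto intro: card_cells_mono elim: surv_mono)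

lemma growth_mono:
  assumes "t \<le> s"
  shows "growth t \<le> growth s"
proof (rule dense_ge)
  fix \<beta> assume "growth s < \<beta>"
  then show "growth t \<le> \<beta>"
    using bounded_growth_antimono[OF bounded_growth_if_less assms] growth_ge_1[of s] by (intro growth_le) auto
qed

section \<open>The growth rate at \<open>t = 1\<close> and below\<close>

lemma growth_1: "growth 1 = 2"
proof (rule antisym)
  show "growth 1 \<le> 2" using bounded_growth_2 by (intro growth_le) auto
  have "card (cells n (surv 1 n)) = 2 ^ n" for n
  proof -
    have "j \<in> cells n (surv 1 n)" if "j < 2 ^ n" for j
    proof -
      have "real j \<le> real (2 ^ n)" using that by (intro of_nat_mono) simp
      then have "real j / 2 ^ n \<le> 1" unfolding of_nat_power of_nat_numeral by (simp add: divide_le_eq_1)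
      then have "surv 1 n (real j / 2 ^ n)"
        using tent_funpow_bounds[of "real j / 2 ^ n"] unfolding surv_def by simp
      then show ?thesis using that unfolding cells_def
        by (intro CollectI conjI exI[of _ "real j / 2 ^ n"]) auto
    qed
    then have "cells n (surv 1 n) = {..<2 ^ n}" by (auto simp: cells_def)
    then show ?thesis by simp
  qed
  then have eq: "bounded_growth 1 \<beta> \<longleftrightarrow> (\<exists>C. \<forall>n. 2 ^ n \<le> C * \<beta> ^ n)" for \<beta>
    by (simp add: exp_bounded_def)
  show "2 \<le> growth 1"
  proof (rule ccontr)
    assume "\<not> 2 \<le> growth 1"
    then obtain \<beta> where \<beta>: "growth 1 < \<beta>" "\<beta> < 2" using dense by (meson not_le)
    then have \<beta>1: "1 < \<beta>" using growth_ge_1[of 1] by linarith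
    obtain C where C: "\<And>n. 2 ^ n \<le> C * \<beta> ^ n" using bounded_growth_if_less[OF \<beta>(1)] eq by blast
    obtain n where "C < (2 / \<beta>) ^ n" using real_arch_pow[of "2 / \<beta>" C] \<beta> \<beta>1 by auto
    then show False using C[of n] \<beta>1 by (simp add: field_simps)
  qed
qed

text \<open>For large \<open>q\<close> the last cell of level \<open>q\<close> lies beyond
  \<open>b\<close>, so at most \<open>2 ^ q - 1\<close> cells survive; submultiplicativity turns
  this into a rate below 2.\<close>

lemma bounded_growth_below_1:
  assumes "b < 1"
  shows "\<exists>\<beta>. 1 \<le> \<beta> \<and> \<beta> < 2 \<and> bounded_growth b \<beta>"
proof -
  obtain q0 where "(1/2) ^ q0 < 1 - b" using real_arch_pow_inv[of "1 - b" "1/2"] assms by auto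
  moreover have "(1/2 :: real) ^ Suc q0 \<le> (1/2) ^ q0" by simp
  ultimately obtain q where q: "q > 0" "(1/2) ^ q < 1 - b" using le_less_trans by blast
  have "cells q (surv b q) \<subseteq> {..<2 ^ q - 1}"
  proof
    fix j assume "j \<in> cells q (surv b q)"
    then obtain v where v: "j < 2 ^ q" "real j \<le> 2 ^ q * v" "v \<le> b"
      using q(1) by (auto simp: cells_def surv_def dest!: spec[of _ 0])
    have "j \<noteq> 2 ^ q - 1"
    proof
      assume "j = 2 ^ q - 1"
      then have "real j = 2 ^ q - 1" by (simp add: of_nat_diff)
      then have "2 ^ q * (1 - v) \<le> 1" using v(2) by (simp add: right_diff_distrib)
      then have "1 - v \<le> (1/2) ^ q" by (simp add: field_simps power_one_over)
      then show False using q(2) v(3) by linarith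
    qed
    then show "j \<in> {..<2 ^ q - 1}" using v(1) by simp
  qed
  then have "card (cells q (surv b q)) \<le> card {..<2 ^ q - 1 :: nat}" by (intro card_mono) auto
  then have "real (card (cells q (surv b q))) \<le> real (2 ^ q - 1)" by (intro of_nat_mono) simp
  then have le: "real (card (cells q (surv b q))) \<le> 2 ^ q - 1" by (simp add: of_nat_diff)
  define \<beta> where "\<beta> = root q (2 ^ q - 1)"
  have "(2::real) ^ 1 \<le> 2 ^ q" using q(1) by (intro power_increasing) auto
  then have "\<beta> ^ q = 2 ^ q - 1" "1 \<le> \<beta>"
    using q(1) unfolding \<beta>_def by (auto simp: real_root_pow_pos2)
  moreover have "\<beta> < 2"
  proof -
    have "\<beta> < root q (2 ^ q)" unfolding \<beta>_def using q(1) by simp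
    then show ?thesis using q(1) by (simp add: real_root_power_cancel)
  qed
  ultimately show ?thesis using exp_bounded_cells_surv[OF q(1), of \<beta> b] le by auto
qed

lemma growth_less_2:
  assumes "b < 1"
  shows "growth b < 2"
proof -
  obtain \<beta> where "1 \<le> \<beta>" "\<beta> < 2" "bounded_growth b \<beta>" using bounded_growth_below_1[OF assms] by blast
  \<comment> \<open>The midpoint exceeds 1 even if \<open>\<beta> = 1\<close>, as
    \<open>growth_le\<close> requires.\<close>
  then have "growth b \<le> (\<beta> + 2) / 2"
    by (intro growth_le exp_bounded_mono[of _ \<beta> "(\<beta> + 2) / 2"]) auto
  then show ?thesis using \<open>\<beta> < 2\<close> by simp
qed

section \<open>Continuity of the growth rate\<close>

lemma growth_right:
  assumes "growth t < \<gamma>"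
  shows "\<exists>s>t. growth s < \<gamma>"
proof -
  obtain \<beta> where \<beta>: "growth t < \<beta>" "\<beta> < \<gamma>" using assms dense by blast
  \<comment> \<open>Compactness loses a little: the rate \<open>\<beta>'\<close> at \<open>t\<close>
    becomes \<open>\<beta>\<close> above \<open>t\<close>.\<close>
  obtain \<beta>' where \<beta>': "growth t < \<beta>'" "\<beta>' < \<beta>" using \<beta>(1) dense by blast
  have b: "1 \<le> \<beta>'" "1 < \<beta>" using growth_ge_1[of t] \<beta>' by linarith+
  have "exp_bounded (\<lambda>n. card (cells n (orbit_le t))) \<beta>'"
    by (rule exp_bounded_le[OF bounded_growth_if_less[OF \<beta>'(1)]])
      (auto intro: card_cells_mono simp: surv_def)
  from exp_bounded_surv_above[OF this b(1) \<beta>'(2)] obtain s where "s > t" "bounded_growth s \<beta>" by blast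
  then show ?thesis using growth_le[OF b(2)] \<beta>(2) by (meson le_less_trans)
qed

text \<open>An orbit point between two parameters close to \<open>t\<close> exceeds both of them
  \<open>n\<close> steps later. Hence survivors for the larger parameter, given \<open>n\<close>
  more steps, survive for the smaller one.\<close>

lemma growth_locally_constant:
  assumes "(tent ^^ n) t > t"
  shows "\<exists>\<eta>>0. \<forall>s. \<bar>s - t\<bar> < \<eta> \<longrightarrow> growth s = growth t"
proof -
  define d where "d = ((tent ^^ n) t - t) / 2"
  have d: "d > 0" using assms by (simp add: d_def)
  obtain \<delta> where \<delta>: "\<delta> > 0" "\<And>y. \<bar>y - t\<bar> < \<delta> \<Longrightarrow> \<bar>(tent ^^ n) y - (tent ^^ n) t\<bar> < d"
    using isCont_tent_funpow[where i=n and x=t] d unfolding continuous_at_eps_delta by (auto simp: dist_real_def)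
  \<comment> \<open>Half of the gap allows for the variation of \<open>tent ^^ n\<close>, the other
    half for that of the threshold.\<close>
  define \<eta> where "\<eta> = min d \<delta>"
  have jump: "t + \<eta> < (tent ^^ n) y" if "\<bar>y - t\<bar> < \<eta>" for y
  proof -
    have "\<bar>(tent ^^ n) y - (tent ^^ n) t\<bar> < d" using that by (intro \<delta>(2)) (simp add: \<eta>_def)
    moreover have "\<eta> \<le> d" by (simp add: \<eta>_def)
    moreover have "2 * d = (tent ^^ n) t - t" by (simp add: d_def)
    ultimately show ?thesis by linarith
  qed
  have bg: "bounded_growth t2 \<beta>"
    if t12: "\<bar>t1 - t\<bar> < \<eta>" "\<bar>t2 - t\<bar> < \<eta>" "t1 \<le> t2" and b: "bounded_growth t1 \<beta>" "1 < \<beta>" for t1 t2 \<beta>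
  proof -
    have sub: "surv t1 m v" if v: "surv t2 (m + n) v" for m v
      unfolding surv_def
    proof (intro allI impI)
      fix i assume "i < m"
      then have "(tent ^^ i) v \<le> t2" "(tent ^^ (n + i)) v \<le> t2" using v by (auto simp: surv_def)
      then have le: "(tent ^^ i) v \<le> t2" "(tent ^^ n) ((tent ^^ i) v) \<le> t2" by (simp_all add: funpow_add)
      show "(tent ^^ i) v \<le> t1"
      proof (rule ccontr)
        assume "\<not> ?thesis"
        then have "\<bar>(tent ^^ i) v - t\<bar> < \<eta>" using le(1) t12 by linarith
        then show False using jump le(2) t12 by fastforce
      qed
    qed
    have "card (cells (m + n) (surv t2 (m + n))) \<le> 2 ^ n * card (cells m (surv t1 m))" for m
    proof -
      have "card (cells (m + n) (surv t2 (m + n))) \<le> card (cells (m + n) (surv t1 m))"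
        by (intro card_cells_mono sub)
      also have "\<dots> \<le> card (cells m (surv t1 m)) * 2 ^ n" by (rule card_cells_refine)
      finally show ?thesis by (simp add: mult.commute)
    qed
    then show ?thesis using b by (intro exp_bounded_shift[OF b(1)]) auto
  qed
  have le: "growth t2 \<le> growth t1" if "\<bar>t1 - t\<bar> < \<eta>" "\<bar>t2 - t\<bar> < \<eta>" "t1 \<le> t2" for t1 t2
  proof (rule dense_ge)
    fix \<beta> assume "growth t1 < \<beta>"
    moreover from this have "1 < \<beta>" using growth_ge_1[of t1] by linarith
    ultimately show "growth t2 \<le> \<beta>" using bg[OF that] bounded_growth_if_less by (intro growth_le) auto
  qed
  have "\<eta> > 0" using d \<delta> by (simp add: \<eta>_def)
  moreover have "growth s = growth t" if "\<bar>s - t\<bar> < \<eta>" for s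
    using le[of s t] le[of t s] growth_mono[of s t] growth_mono[of t s] that \<open>\<eta> > 0\<close>
    by (cases "s \<le> t") auto
  ultimately show ?thesis by blast
qed

lemma growth_left:
  assumes t: "1/2 < t" "t \<le> 1" and "\<gamma> < growth t"
  shows "\<exists>s<t. \<gamma> < growth s"
proof (cases "\<forall>k. (tent ^^ k) t \<le> t")
  case False
  then obtain \<eta> where \<eta>: "\<eta> > 0" "\<And>s. \<bar>s - t\<bar> < \<eta> \<Longrightarrow> growth s = growth t"
    using growth_locally_constant by (meson not_le)
  have "growth (t - \<eta> / 2) = growth t" by (rule \<eta>(2)) (use \<eta>(1) in simp)
  then show ?thesis by (intro exI[of _ "t - \<eta> / 2"]) (use assms(3) \<eta>(1) in simp)
next
  case True
  show ?thesis
  proof (rule ccontr)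
    assume "\<not> ?thesis"
    then have le: "growth s \<le> \<gamma>" if "s < t" for s using that by force
    obtain \<beta>' where \<beta>': "\<gamma> < \<beta>'" "\<beta>' < growth t" using assms(3) dense by blast
    obtain \<beta> where \<beta>: "\<gamma> < \<beta>" "\<beta> < \<beta>'" using \<beta>'(1) dense by blast
    have b1: "1 \<le> \<beta>" using le[of 0] growth_ge_1[of 0] t \<beta> by linarith
    have "bounded_growth t \<beta>'"
      using True le \<beta> b1 by (intro exp_bounded_left_limit[OF t _ _ \<beta>(2)] bounded_growth_if_less) (auto intro: le_less_trans)
    then have "growth t \<le> \<beta>'" using b1 \<beta> by (intro growth_le) auto
    then show False using \<beta>' by simp
  qed
qed

lemma isCont_growth:
  assumes "1/2 < t" "t \<le> 1"
  shows "isCont growth t"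
  unfolding isCont_def
proof (rule order_tendstoI)
  fix l assume "l < growth t"
  then obtain s where "s < t" "l < growth s" using growth_left[OF assms] by blast
  then have "l < growth u" if "u \<in> {s<..}" for u using growth_mono[of s u] that by simp
  then show "\<forall>\<^sub>F u in at t. l < growth u"
    using \<open>s < t\<close> by (intro eventually_at_in_open'[THEN eventually_mono, of "{s<..}"]) auto
next
  fix l assume "growth t < l"
  then obtain s where "t < s" "growth s < l" using growth_right by blast
  then have "growth u < l" if "u \<in> {..<s}" for u using growth_mono[of u s] that by simp
  then show "\<forall>\<^sub>F u in at t. growth u < l"
    using \<open>t < s\<close> by (intro eventually_at_in_open'[THEN eventually_mono, of "{..<s}"]) auto
qed

section \<open>Entropy as the logarithm of the growth rate\<close>

lemma topological_entropy_attractor: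
  assumes a: "a \<in> {1/3..1/2}"
  shows "topological_entropy (attractor_space a) doubling = ereal (log 2 (growth (2 * a)))"
proof (rule antisym; rule ccontr)
  have g1: "1 \<le> growth (2 * a)" by (rule growth_ge_1)
  {
    assume "\<not> topological_entropy (attractor_space a) doubling \<le> ereal (log 2 (growth (2 * a)))"
    then obtain r where r: "log 2 (growth (2 * a)) < r" "ereal r < topological_entropy (attractor_space a) doubling"
      using ereal_dense2 by (metis ereal_less_eq(3) less_ereal.simps(1) not_le)
    then have "growth (2 * a) < 2 powr r" using g1 by (simp add: log_less_iff)
    then have "topological_entropy (attractor_space a) doubling \<le> ereal (log 2 (2 powr r))"
      using g1 by (intro topological_entropy_le bounded_growth_if_less) auto
    then show False using r(2) by simp
  next
    assume "\<not> ereal (log 2 (growth (2 * a))) \<le> topological_entropy (attractor_space a) doubling"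
    then obtain r where r: "topological_entropy (attractor_space a) doubling < ereal r" "r < log 2 (growth (2 * a))"
      using ereal_dense2 by (metis less_ereal.simps(1) not_le)
    have "ereal 0 < ereal r" using r(1) topological_entropy_nonneg[of a] by (simp only: zero_ereal_def)
    then have b1: "1 < 2 powr r" by simp
    have "2 powr r < growth (2 * a)" using r(2) g1 by (simp add: less_log_iff)
    then obtain \<gamma> where \<gamma>: "2 powr r < \<gamma>" "\<gamma> < growth (2 * a)" using dense by blast
    have "exp_bounded (\<lambda>n. card (core_cells (2 * a) n)) (2 powr r)"
      using r(1) b1 by (intro exp_bounded_core[OF a]) auto
    then have "exp_bounded (\<lambda>n. card (cells n (orbit_le (2 * a)))) (2 powr r)"
      using b1 by (rule exp_bounded_orbit_cells)
    \<comment> \<open>Compactness turns the bound for whole orbits into one for finite survival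
      above \<open>2 * a\<close>, which monotonicity brings back to \<open>2 * a\<close>.\<close>
    then obtain s where "s > 2 * a" "bounded_growth s \<gamma>"
      using exp_bounded_surv_above[OF _ _ \<gamma>(1)] b1 by (meson less_imp_le)
    then have "growth (2 * a) \<le> \<gamma>"
      using bounded_growth_antimono[of s \<gamma> "2 * a"] b1 \<gamma>(1) by (intro growth_le) auto
    then show False using \<gamma>(2) by simp
  }
qed

section \<open>The exceptional parameters\<close>

text \<open>The cells of level \<open>n\<close> that cover the set have total length at most
  \<open>C * (\<beta> / 2) ^ n\<close>, and \<open>\<beta> < 2\<close>.\<close>

lemma negligible_orbit_le:
  assumes "b < 1"
  shows "negligible {v. 0 \<le> v \<and> v \<le> 1 \<and> orbit_le b v}"
  unfolding negligible_outer_le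
proof (intro allI impI)
  fix e :: real assume e: "e > 0"
  obtain \<beta> where \<beta>: "1 \<le> \<beta>" "\<beta> < 2" "bounded_growth b \<beta>" using bounded_growth_below_1[OF assms] by blast
  obtain C where C: "C \<ge> 0" "\<And>n. real (card (cells n (surv b n))) \<le> C * \<beta> ^ n"
    using exp_bounded_const_nonneg[OF \<beta>(3)] by blast
  have "(\<lambda>n. C * (\<beta> / 2) ^ n) \<longlonglongrightarrow> C * 0"
    using \<beta> by (intro tendsto_intros LIMSEQ_realpow_zero) auto
  then have "\<forall>\<^sub>F n in sequentially. C * (\<beta> / 2) ^ n < e" using e by (intro order_tendstoD) auto
  then obtain n where n: "C * (\<beta> / 2) ^ n < e" by (auto simp: eventually_sequentially)
  define I where "I = (\<lambda>j::nat. {real j / 2 ^ n .. (real j + 1) / 2 ^ n})"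
  define T where "T = (\<Union>j\<in>cells n (surv b n). I j)"
  have "{v. 0 \<le> v \<and> v \<le> 1 \<and> orbit_le b v} \<subseteq> T"
  proof
    fix v assume "v \<in> {v. 0 \<le> v \<and> v \<le> 1 \<and> orbit_le b v}"
    then have v: "0 \<le> v" "v \<le> 1" "orbit_le b v" by auto
    obtain j where j: "j < 2 ^ n" "real j \<le> 2 ^ n * v" "2 ^ n * v \<le> real j + 1"
      using cell_exists[OF v(1,2)] by blast
    then have "j \<in> cells n (surv b n)" using v(3) by (auto simp: cells_def surv_def)
    moreover have "v \<in> I j" using j by (simp add: I_def field_simps)
    ultimately show "v \<in> T" by (auto simp: T_def)
  qed
  moreover have "T \<in> lmeasurable" unfolding T_def I_def by (intro lmeasurable_compact compact_UN) auto
  moreover have "measure lebesgue T \<le> e"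
  proof -
    have "measure lebesgue T \<le> (\<Sum>j\<in>cells n (surv b n). measure lebesgue (I j))"
      unfolding T_def I_def by (intro measure_UNION_le) auto
    also have "\<dots> = (\<Sum>j\<in>cells n (surv b n). 1 / 2 ^ n)"
      by (intro sum.cong) (auto simp: I_def divide_right_mono simp flip: diff_divide_distrib)
    also have "\<dots> = real (card (cells n (surv b n))) / 2 ^ n" by simp
    also have "\<dots> \<le> C * \<beta> ^ n / 2 ^ n" using C(2) by (intro divide_right_mono) auto
    finally show ?thesis using n by (simp add: power_divide)
  qed
  ultimately show "\<exists>T. {v. 0 \<le> v \<and> v \<le> 1 \<and> orbit_le b v} \<subseteq> T \<and> T \<in> lmeasurable \<and> measure lebesgue T \<le> e"
    by blast
qed

definition exceptional :: "real set" where
  "exceptional = {a \<in> {1/3..1/2}. orbit_le (2 * a) (2 * a)}"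

text \<open>An exceptional parameter \<open>2 * a\<close> is itself a survivor for
  \<open>2 * a\<close>, hence for every larger bound. The bounds \<open>1 - 1 / (real m + 1)\<close>
  exceed any given \<open>2 * a < 1\<close>, and \<open>a = 1/2\<close> is a single point.\<close>

lemma null_sets_exceptional: "exceptional \<in> null_sets lebesgue"
proof -
  define S where "S = (\<lambda>m::nat. {v. 0 \<le> v \<and> v \<le> 1 \<and> orbit_le (1 - 1 / (real m + 1)) v})"
  have "negligible ((*\<^sub>R) (1/2) ` S m)" for m
    unfolding S_def
    by (intro negligible_differentiable_image_negligible negligible_orbit_le) (auto intro!: derivative_intros)
  then have neg: "negligible ((\<Union>m. (*\<^sub>R) (1/2) ` S m) \<union> {1/2})"
    by (intro negligible_Un negligible_Union_nat) auto
  have "exceptional \<subseteq> (\<Union>m. (*\<^sub>R) (1/2) ` S m) \<union> {1/2}"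
  proof
    fix a assume a: "a \<in> exceptional"
    show "a \<in> (\<Union>m. (*\<^sub>R) (1/2) ` S m) \<union> {1/2}"
    proof (cases "a = 1/2")
      case False
      then have "0 < 1 - 2 * a" using a by (auto simp: exceptional_def)
      then obtain m where m: "1 / (real m + 1) < 1 - 2 * a"
        using reals_Archimedean by (metis inverse_eq_divide of_nat_Suc add.commute)
      then have "2 * a \<in> S m" using a unfolding S_def exceptional_def
        by (auto intro: order_trans[of _ "2 * a"])
      then have "a \<in> (*\<^sub>R) (1/2) ` S m" by (intro image_eqI[of _ _ "2 * a"]) auto
      then show ?thesis by blast
    qed simp
  qed
  then show ?thesis using negligible_subset[OF neg] negligible_iff_null_sets by blast
qed

theorem mainTheorem4:
  shows "\<exists>h :: real \<Rightarrow> real.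
    (\<forall>a\<in>{1/3..1/2}. topological_entropy (attractor_space a) doubling = ereal (h a)) \<and>
    devils_staircase (1/3) (1/2) h"
proof -
  define h where "h = (\<lambda>a. log 2 (growth (2 * a)))"
  have pos: "0 < growth t" for t using growth_ge_1[of t] by linarith
  have "continuous_on {1/3..1/2} h"
    unfolding h_def
  proof (intro continuous_at_imp_continuous_on ballI)
    fix a :: real assume "a \<in> {1/3..1/2}"
    then have "isCont growth (2 * a)" by (intro isCont_growth) auto
    moreover have "isCont (\<lambda>a. 2 * a) a" by simp
    ultimately have "isCont (\<lambda>a. growth (2 * a)) a" by (rule isCont_o2[rotated])
    moreover have "growth (2 * a) \<noteq> 0" using pos[of "2 * a"] by simp
    ultimately show "isCont (\<lambda>a. log 2 (growth (2 * a))) a"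
      unfolding isCont_def using pos by (intro tendsto_log tendsto_const) auto
  qed
  moreover have "mono_on {1/3..1/2} h"
    using pos growth_mono by (auto intro!: monotone_onI simp: h_def)
  moreover have "h (1/3) < h (1/2)"
    using growth_less_2[of "2/3"] growth_1 pos[of "2/3"] by (simp add: h_def log_less_iff)
  moreover have "(h has_real_derivative 0) (at a within {1/3..1/2})" if a: "a \<in> {1/3..1/2} - exceptional" for a
  proof -
    obtain n where "2 * a < (tent ^^ n) (2 * a)" using a by (auto simp: exceptional_def not_le)
    then obtain \<eta> where \<eta>: "\<eta> > 0" "\<And>s. \<bar>s - 2 * a\<bar> < \<eta> \<Longrightarrow> growth s = growth (2 * a)"
      using growth_locally_constant by blast
    have "((\<lambda>_. h a) has_real_derivative 0) (at a within {1/3..1/2})" by simp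
    then show ?thesis
    \<comment> \<open>The radius is halved because \<open>growth\<close> is evaluated at
      \<open>2 * a\<close>.\<close>
    proof (rule has_field_derivative_transform_within[of _ _ _ _ "\<eta> / 2"])
      fix b assume "dist b a < \<eta> / 2"
      then have "\<bar>2 * b - 2 * a\<bar> < \<eta>" unfolding dist_real_def by linarith
      then have "growth (2 * b) = growth (2 * a)" by (rule \<eta>(2))
      then show "h a = h b" by (simp add: h_def)
    qed (use \<eta>(1) a in auto)
  qed
  ultimately have "devils_staircase (1/3) (1/2) h"
    unfolding devils_staircase_def
    by (intro conjI disjI1 bexI[OF _ null_sets_exceptional] ballI) simp_all
  moreover have "\<forall>a\<in>{1/3..1/2}. topological_entropy (attractor_space a) doubling = ereal (h a)"
    using topological_entropy_attractor unfolding h_def by blast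
  ultimately show ?thesis by blast
qed

end
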